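(* For $k=1,\dots,n$ let $\{T_{k,w}\}_{w\in\Omega}\subset End_{\mathcal A}^{*}(\mathcal H)$ be a continuous operator frame for $End_{\mathcal A}^{*}(\mathcal H)$ with bounds $A_k$ and $B_k$, and let $\{R_{k,w}\}_{w\in\Omega}\subset End_{\mathcal A}^{*}(\mathcal H)$. Let $L:l^2(\mathcal H)\to l^2(\mathcal H)$ be a bounded linear operator such that, for some $p\in\{1,\dots,n\}$, $$L\Big(\Big\{\sum_{k=1}^nR_{k,w}x\Big\}_{w\in\Omega}\Big)=\{T_{p,w}x\}_{w\in\Omega}\qquad\text{for all }x\in\mathcal H.$$ If there exists a constant $\lambda>0$ such that for each $x\in\mathcal H$ and each $k=1,\dots,n$, $$\Big\|\int_\Omega\langle(T_{k,w}-R_{k,w})x,(T_{k,w}-R_{k,w})x\rangle_{\mathcal A}\,d\mu(w)\Big\|\le\lambda\Big\|\int_\Omega\langle T_{k,w}x,T_{k,w}x\rangle_{\mathcal A}\,d\mu(w)\Big\|,$$ then $\{\sum_{k=1}^nR_{k,w}\}_{w\in\Omega}$ is a continuous operator frame for $End_{\mathcal A}^{*}(\mathcal H)$.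
   Context: $\mathcal A$ is a unital $C^*$-algebra, $\mathcal H$ is a (left) Hilbert $\mathcal A$-module with $\mathcal A$-valued inner product $\langle\cdot,\cdot\rangle_{\mathcal A}$ ($\mathcal A$-linear in the first variable) and norm $\|x\|=\|\langle x,x\rangle_{\mathcal A}\|^{1/2}$, and $End_{\mathcal A}^{*}(\mathcal H)$ is the set of adjointable operators $\mathcal H\to\mathcal H$. $(\Omega,\mu)$ is a measure space; integrals of Banach-space-valued functions are Bochner integrals. Inequalities between elements of $\mathcal A$ refer to the order given by the positive cone $\mathcal A^+$. $l^2(\mathcal H)$ denotes the space of (measurable) families $\{x_w\}_{w\in\Omega}$ in $\mathcal H$ with $\big\|\int_\Omega\langle x_w,x_w\rangle_{\mathcal A}\,d\mu(w)\big\|<\infty$, with $\mathcal A$-valued inner product $\langle x,y\rangle=\int_\Omega\langle x_w,y_w\rangle_{\mathcal A}\,d\mu(w)$ and norm $\|\{x_w\}_{w\in\Omega}\|=\|\langle x,x\rangle\|^{1/2}$ (families equal almost everywhere being identified). A family $\{\Lambda_w\}_{w\in\Omega}\subset End_{\mathcal A}^{*}(\mathcal H)$ is a continuous operator frame for $End_{\mathcal A}^{*}(\mathcal H)$ with bounds $A,B>0$ if (a) for every $x\in\mathcal H$ the map $w\mapsto\Lambda_w x$ is measurable, and (b) for every $x\in\mathcal H$, $A\langle x,x\rangle_{\mathcal A}\le\int_\Omega\langle\Lambda_w x,\Lambda_w x\rangle_{\mathcal A}\,d\mu(w)\le B\langle x,x\rangle_{\mathcal A}$. It is called a continuous operator frame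 if such $A,B>0$ exist. Convention: for all families of operators considered, $w\mapsto R_{k,w}x$ is measurable for each $x\in\mathcal H$, and an inequality involving integrals includes the assertion that these integrals exist. *)

theory Defs
  imports "HOL-Analysis.Analysis"
begin

section \<open>Unital C*-algebras\<close>

text \<open>
  The libraries have no class of complex normed algebras, so complex scalars are added to a real
  Banach algebra. The class real_normed_algebra_1 includes the usual normalisation
  \<^prop>\<open>norm 1 = 1\<close> (hence \<^prop>\<open>1 \<noteq> 0\<close>) of a unital algebra.
\<close>

class cstar_algebra = real_normed_algebra_1 + banach +
  fixes scaleC :: "complex \<Rightarrow> 'a \<Rightarrow> 'a" (infixr "*\<^sub>C" 75)
    and star :: "'a \<Rightarrow> 'a"
  assumes scaleC_of_real: "complex_of_real r *\<^sub>C a = r *\<^sub>R a"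
    and scaleC_add_right: "c *\<^sub>C (a + b) = c *\<^sub>C a + c *\<^sub>C b"
    and scaleC_add_left: "(c + d) *\<^sub>C a = c *\<^sub>C a + d *\<^sub>C a"
    and scaleC_scaleC: "c *\<^sub>C d *\<^sub>C a = (c * d) *\<^sub>C a"
    and mult_scaleC_left: "(c *\<^sub>C a) * b = c *\<^sub>C (a * b)"
    and mult_scaleC_right: "a * (c *\<^sub>C b) = c *\<^sub>C (a * b)"
    and norm_scaleC: "norm (c *\<^sub>C a) = cmod c * norm a"
    and star_add: "star (a + b) = star a + star b"
    and star_scaleC: "star (c *\<^sub>C a) = cnj c *\<^sub>C star a"
    and star_mult: "star (a * b) = star b * star a"
    and star_star: "star (star a) = a"
    and cstar_identity: "norm (star a * a) = (norm a)\<^sup>2"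

definition spectrum :: "'a::cstar_algebra \<Rightarrow> complex set" where
  "spectrum a = {z. \<not> (\<exists>b. b * (z *\<^sub>C 1 - a) = 1 \<and> (z *\<^sub>C 1 - a) * b = 1)}"

definition cstar_positive :: "'a::cstar_algebra \<Rightarrow> bool" where
  "cstar_positive a \<longleftrightarrow> star a = a \<and> spectrum a \<subseteq> \<real>\<^sub>\<ge>\<^sub>0"

definition cstar_le :: "'a::cstar_algebra \<Rightarrow> 'a \<Rightarrow> bool" (infix "\<preceq>" 50) where
  "a \<preceq> b \<longleftrightarrow> cstar_positive (b - a)"


section \<open>Hilbert C*-modules and adjointable operators\<close>

text \<open>
  The norm and the real scalar multiplication of the type \<open>'h\<close> are tied to the module structure by
  the last two assumptions; completeness is part of \<^class>\<open>banach\<close>. Complex scalars act on the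
  module through the multiples of the unit.
\<close>

locale hilbert_cstar_module =
  fixes act :: "'a::cstar_algebra \<Rightarrow> 'h::banach \<Rightarrow> 'h"
    and ip :: "'h \<Rightarrow> 'h \<Rightarrow> 'a"
  assumes act_add_right: "act a (x + y) = act a x + act a y"
    and act_add_left: "act (a + b) x = act a x + act b x"
    and act_act: "act a (act b x) = act (a * b) x"
    and act_one: "act 1 x = x"
    and ip_add_left: "ip (x + y) z = ip x z + ip y z"
    and ip_act_left: "ip (act a x) y = a * ip x y"
    and ip_commute: "ip y x = star (ip x y)"
    and ip_positive: "cstar_positive (ip x x)"
    and ip_definite: "ip x x = 0 \<Longrightarrow> x = 0"
    and scaleR_eq_act: "r *\<^sub>R x = act (r *\<^sub>R 1) x"
    and norm_eq_sqrt_ip: "norm x = sqrt (norm (ip x x))"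

text \<open>Adjointable maps are automatically module-linear and bounded.\<close>

definition adjointable :: "('h \<Rightarrow> 'h \<Rightarrow> 'a) \<Rightarrow> ('h \<Rightarrow> 'h) set" where
  "adjointable ip = {F. \<exists>G. \<forall>x y. ip (F x) y = ip x (G y)}"


section \<open>Bochner integration in arbitrary Banach spaces\<close>

text \<open>
  The library's \<^const>\<open>has_bochner_integral\<close> requires a second countable, that is separable, value
  space. The definition below is the same, with Borel measurability replaced by strong
  measurability, and applies to every normed space. Strong measurability is also the meaning of
  measurability for families of vectors.
\<close>

definition strongly_measurable :: "'w measure \<Rightarrow> ('w \<Rightarrow> 'b::real_normed_vector) \<Rightarrow> bool" where
  "strongly_measurable M f \<longleftrightarrow>
     (\<exists>s. (\<forall>i. simple_function M (s i)) \<and> (AE w in M. (\<lambda>i::nat. s i w) \<longlonglongrightarrow> f w))"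

definition has_banach_integral ::
    "'w measure \<Rightarrow> ('w \<Rightarrow> 'b::real_normed_vector) \<Rightarrow> 'b \<Rightarrow> bool" where
  "has_banach_integral M f I \<longleftrightarrow>
     strongly_measurable M f \<and>
     (\<exists>s. (\<forall>i::nat. Bochner_Integration.simple_bochner_integrable M (s i)) \<and>
          (\<lambda>i. \<integral>\<^sup>+ w. norm (f w - s i w) \<partial>M) \<longlonglongrightarrow> 0 \<and>
          (\<lambda>i. Bochner_Integration.simple_bochner_integral M (s i)) \<longlonglongrightarrow> I)"

definition banach_integrable :: "'w measure \<Rightarrow> ('w \<Rightarrow> 'b::real_normed_vector) \<Rightarrow> bool" where
  "banach_integrable M f \<longleftrightarrow> (\<exists>I. has_banach_integral M f I)"

definition banach_integral :: "'w measure \<Rightarrow> ('w \<Rightarrow> 'b::real_normed_vector) \<Rightarrow> 'b" where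
  "banach_integral M f = (THE I. has_banach_integral M f I)"


section \<open>The space of square-integrable families\<close>

definition l2_families ::
    "'w measure \<Rightarrow> ('h::banach \<Rightarrow> 'h \<Rightarrow> 'a::cstar_algebra) \<Rightarrow> ('w \<Rightarrow> 'h) set" where
  "l2_families M ip =
     {f. strongly_measurable M f \<and> banach_integrable M (\<lambda>w. ip (f w) (f w))}"

definition l2_norm ::
    "'w measure \<Rightarrow> ('h::banach \<Rightarrow> 'h \<Rightarrow> 'a::cstar_algebra) \<Rightarrow> ('w \<Rightarrow> 'h) \<Rightarrow> real" where
  "l2_norm M ip f = sqrt (norm (banach_integral M (\<lambda>w. ip (f w) (f w))))"

text \<open>
  Families that agree almost everywhere are identified. An operator on the space of classes is
  given by a map on representatives that respects this identification; its complex linearity is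
  expressed up to null sets.
\<close>

definition l2_bounded_linear ::
    "'w measure \<Rightarrow> ('a::cstar_algebra \<Rightarrow> 'h::banach \<Rightarrow> 'h) \<Rightarrow> ('h \<Rightarrow> 'h \<Rightarrow> 'a) \<Rightarrow>
      (('w \<Rightarrow> 'h) \<Rightarrow> ('w \<Rightarrow> 'h)) \<Rightarrow> bool" where
  "l2_bounded_linear M act ip L \<longleftrightarrow>
     (\<forall>f \<in> l2_families M ip. L f \<in> l2_families M ip) \<and>
     (\<forall>f \<in> l2_families M ip. \<forall>g \<in> l2_families M ip.
        (AE w in M. f w = g w) \<longrightarrow> (AE w in M. L f w = L g w)) \<and>
     (\<forall>f \<in> l2_families M ip. \<forall>g \<in> l2_families M ip.
        AE w in M. L (\<lambda>w. f w + g w) w = L f w + L g w) \<and>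
     (\<forall>c. \<forall>f \<in> l2_families M ip.
        AE w in M. L (\<lambda>w. act (c *\<^sub>C 1) (f w)) w = act (c *\<^sub>C 1) (L f w)) \<and>
     (\<exists>K. \<forall>f \<in> l2_families M ip. l2_norm M ip (L f) \<le> K * l2_norm M ip f)"


section \<open>Continuous operator frames\<close>

definition operator_frame_bounds ::
    "'w measure \<Rightarrow> ('h::banach \<Rightarrow> 'h \<Rightarrow> 'a::cstar_algebra) \<Rightarrow>
      ('w \<Rightarrow> 'h \<Rightarrow> 'h) \<Rightarrow> real \<Rightarrow> real \<Rightarrow> bool" where
  "operator_frame_bounds M ip F A B \<longleftrightarrow>
     0 < A \<and> 0 < B \<and>
     (\<forall>w \<in> space M. F w \<in> adjointable ip) \<and>
     (\<forall>x. strongly_measurable M (\<lambda>w. F w x)) \<and>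
     (\<forall>x. banach_integrable M (\<lambda>w. ip (F w x) (F w x)) \<and>
          A *\<^sub>R ip x x \<preceq> banach_integral M (\<lambda>w. ip (F w x) (F w x)) \<and>
          banach_integral M (\<lambda>w. ip (F w x) (F w x)) \<preceq> B *\<^sub>R ip x x)"

definition continuous_operator_frame ::
    "'w measure \<Rightarrow> ('h::banach \<Rightarrow> 'h \<Rightarrow> 'a::cstar_algebra) \<Rightarrow> ('w \<Rightarrow> 'h \<Rightarrow> 'h) \<Rightarrow> bool" where
  "continuous_operator_frame M ip F \<longleftrightarrow> (\<exists>A B. operator_frame_bounds M ip F A B)"

end

theory Submission
  imports Defs "HOL-Computational_Algebra.Formal_Power_Series"
begin

text \<open>
  The two frame inequalities for \<open>F w = (\<Sum>k=1..n. R k w)\<close> are first proved with norms in place of the order of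
  the algebra. Write \<open>S x\<close> for the integral of \<open>ip (F w x) (F w x)\<close>.

  Upper bound: \<open>R k\<close> is the difference of \<open>T k\<close> and \<open>T k - R k\<close>. The norm of the integral is bounded by a multiple
  of \<open>(norm x)\<^sup>2\<close> for \<open>T k\<close> by its upper frame bound, and then for \<open>T k - R k\<close> by the perturbation hypothesis. Such
  bounds are stable under sums and differences by the parallelogram law in the module (\<open>norm_gram_add_le\<close>), so
  \<open>norm (S x) \<le> D * (norm x)\<^sup>2\<close>.

  Lower bound: the operator \<open>L\<close> maps the family of \<open>F w x\<close> to that of \<open>T p w x\<close>. Boundedness of \<open>L\<close> together with the
  lower frame bound of \<open>T p\<close> gives \<open>c * (norm x)\<^sup>2 \<le> norm (S x)\<close>.

  The main point is that norm inequalities valid for all vectors imply order inequalities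
  (\<open>frame_of_norm_bounds\<close>). Both \<open>x \<mapsto> S x\<close> and \<open>x \<mapsto> ip x x\<close> turn the action of \<open>b\<close> on \<open>x\<close> into conjugation by \<open>b\<close>.
  To get \<open>S x \<preceq> D ip x x\<close>, the norm inequality is used for the vector \<open>b x\<close> with \<open>b = (ip x x + \<epsilon>) powr (- 1 / 2)\<close>,
  for which \<open>ip (b x) (b x)\<close> is at most 1 (\<open>cstar_le_of_norm_le\<close>); the lower inequality is the
  same argument with \<open>S x\<close> and \<open>ip x x\<close> exchanged.

  The ingredients from C*-algebra theory are that the norm of a self-adjoint element is bounded by any bound
  for its spectrum (\<open>norm_le_of_spectrum_bound\<close>), the resulting description of positive elements by the inequality
  \<open>norm (t - a) \<le> t\<close>, and inverse square roots from the binomial series (\<open>inverse_square_root\<close>). The description of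
  positivity by a norm inequality also shows that Bochner integrals of positive functions are positive
  (\<open>has_banach_integral_positive\<close>).
\<close>

section \<open>Invertible elements\<close>

definition unit_elt :: "'a::monoid_mult \<Rightarrow> bool" where
  "unit_elt a \<longleftrightarrow> (\<exists>b. b * a = 1 \<and> a * b = 1)"

lemma unit_eltI:
  assumes "b * a = 1" "a * c = 1"
  shows "unit_elt a"
proof -
  have "b = (b * a) * c" by (simp only: mult.assoc assms(2) mult_1_right)
  also have "\<dots> = c" by (simp add: assms)
  finally show ?thesis using assms unfolding unit_elt_def by blast
qed

lemma unit_elt_mult:
  assumes "unit_elt a" "unit_elt b"
  shows "unit_elt (a * b)"
proof -
  obtain c d where c: "c * a = 1" "a * c = 1" and d: "d * b = 1" "b * d = 1"
    using assms unfolding unit_elt_def by blast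
  have "(d * c) * (a * b) = d * (c * a) * b" by (simp only: mult.assoc)
  moreover have "(a * b) * (d * c) = a * (b * d) * c" by (simp only: mult.assoc)
  ultimately show ?thesis by (intro unit_eltI[of "d * c" _ "d * c"]) (simp_all add: c d)
qed

lemma unit_elt_uminus_iff [simp]:
  fixes a :: "'a::ring_1"
  shows "unit_elt (- a) \<longleftrightarrow> unit_elt a"
proof -
  have "unit_elt (- x)" if "unit_elt x" for x :: 'a
    using that unfolding unit_elt_def by (metis minus_mult_minus)
  from this[of a] this[of "- a"] show ?thesis by auto
qed

lemma geometric_series_inverse:
  fixes a :: "'a::{real_normed_algebra_1, banach}"
  assumes "norm a < 1"
  shows "(\<Sum>n. a ^ n) * (1 - a) = 1" "(1 - a) * (\<Sum>n. a ^ n) = 1"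
proof -
  have "summable (\<lambda>n. norm (a ^ n))"
    using assms
    by (intro summable_comparison_test'[OF summable_geometric[of "norm a"], of 0])
      (simp_all add: norm_power_ineq)
  then have s: "summable (\<lambda>n. a ^ n)" by (rule summable_norm_cancel)
  have "(\<lambda>n. a ^ n - a ^ Suc n) sums (a ^ 0 - 0)"
    by (rule telescope_sums'[OF LIMSEQ_power_zero[OF assms]])
  then have t: "(\<lambda>n. a ^ n - a ^ Suc n) sums 1" by simp
  have "(\<lambda>n. a ^ n * (1 - a)) sums ((\<Sum>n. a ^ n) * (1 - a))"
    by (rule sums_mult2[OF summable_sums[OF s]])
  moreover have "a ^ n * (1 - a) = a ^ n - a ^ Suc n" for n
    by (simp add: algebra_simps power_commutes)
  ultimately show "(\<Sum>n. a ^ n) * (1 - a) = 1" using t sums_unique2 by simp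
  have "(\<lambda>n. (1 - a) * a ^ n) sums ((1 - a) * (\<Sum>n. a ^ n))"
    by (rule sums_mult[OF summable_sums[OF s]])
  moreover have "(1 - a) * a ^ n = a ^ n - a ^ Suc n" for n
    by (simp add: algebra_simps)
  ultimately show "(1 - a) * (\<Sum>n. a ^ n) = 1" using t sums_unique2 by simp
qed

lemma unit_elt_one_minus:
  fixes a :: "'a::{real_normed_algebra_1, banach}"
  assumes "norm a < 1"
  shows "unit_elt (1 - a)"
  using geometric_series_inverse[OF assms] by (rule unit_eltI)

section \<open>Star and complex scalars\<close>

lemma scaleC_zero_left [simp]: "0 *\<^sub>C (a::'a::cstar_algebra) = 0"
  using scaleC_of_real[of 0 a] by simp

lemma scaleC_one [simp]: "1 *\<^sub>C (a::'a::cstar_algebra) = a"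
  using scaleC_of_real[of 1 a] by simp

lemma scaleC_zero_right [simp]: "c *\<^sub>C (0::'a::cstar_algebra) = 0"
  using scaleC_add_right[of c "0::'a" 0] by simp

lemma scaleC_minus_right: "c *\<^sub>C (- a::'a::cstar_algebra) = - (c *\<^sub>C a)"
  using scaleC_add_right[of c "a" "- a"] by (simp add: minus_unique)

lemma scaleC_diff_right: "c *\<^sub>C (a - b::'a::cstar_algebra) = c *\<^sub>C a - c *\<^sub>C b"
  using scaleC_add_right[of c a "- b"] by (simp add: scaleC_minus_right)

lemma scaleC_minus_left: "(- c) *\<^sub>C (a::'a::cstar_algebra) = - (c *\<^sub>C a)"
  using scaleC_add_left[of c "- c" a] by (simp add: minus_unique)

lemma scaleC_diff_left: "(c - d) *\<^sub>C (a::'a::cstar_algebra) = c *\<^sub>C a - d *\<^sub>C a"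
  using scaleC_add_left[of c "- d" a] by (simp add: scaleC_minus_left)

lemma scaleR_eq_scaleC: "r *\<^sub>R (a::'a::cstar_algebra) = complex_of_real r *\<^sub>C a"
  by (simp add: scaleC_of_real)

lemma star_scaleR: "star (r *\<^sub>R a :: 'a::cstar_algebra) = r *\<^sub>R star a"
  using star_scaleC[of "complex_of_real r" a] by (simp add: scaleC_of_real)

lemma star_one [simp]: "star (1::'a::cstar_algebra) = 1"
  using star_mult[of "star 1" "1::'a"] by (simp add: star_star)

lemma star_minus: "star (- a :: 'a::cstar_algebra) = - star a"
  using star_scaleR[of "-1" a] by simp

lemma star_diff: "star (a - b :: 'a::cstar_algebra) = star a - star b"
  using star_add[of a "- b"] by (simp add: star_minus)

lemma star_power: "star (a ^ n :: 'a::cstar_algebra) = star a ^ n"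
  by (induction n) (simp_all add: star_mult power_commutes)

text \<open>
  The C*-identity gives \<open>(norm b)\<^sup>2 \<le> norm (star b) * norm b\<close>; the other inequality is the same one at
  \<open>star b\<close>.
\<close>

lemma norm_star [simp]: "norm (star (a::'a::cstar_algebra)) = norm a"
proof -
  have le: "norm b \<le> norm (star b)" for b :: 'a
  proof (cases "b = 0")
    case False
    have "norm b * norm b \<le> norm (star b) * norm b"
      using cstar_identity[of b] norm_mult_ineq[of "star b" b] by (simp add: power2_eq_square)
    then show ?thesis using False by simp
  qed simp
  from le[of a] le[of "star a"] show ?thesis by (simp add: star_star)
qed

lemma bounded_linear_star: "bounded_linear (star :: 'a::cstar_algebra \<Rightarrow> 'a)"
  by (rule bounded_linear_intro[of _ 1]) (simp_all add: star_add star_scaleR)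

section \<open>Spectrum\<close>

lemma mem_spectrum_iff: "z \<in> spectrum a \<longleftrightarrow> \<not> unit_elt (z *\<^sub>C 1 - a)"
  by (simp add: spectrum_def unit_elt_def)

lemma unit_elt_scaleC:
  fixes a :: "'a::cstar_algebra"
  assumes "c \<noteq> 0" "unit_elt a"
  shows "unit_elt (c *\<^sub>C a)"
proof -
  obtain b where "b * a = 1" "a * b = 1" using assms(2) unfolding unit_elt_def by blast
  then show ?thesis
    by (intro unit_eltI[of "(1/c) *\<^sub>C b" _ "(1/c) *\<^sub>C b"])
      (simp_all add: mult_scaleC_left mult_scaleC_right scaleC_scaleC assms(1))
qed

lemma unit_elt_one_minus_scaleC:
  fixes a :: "'a::cstar_algebra"
  assumes "z \<noteq> 0" "1 / z \<notin> spectrum a"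
  shows "unit_elt (1 - z *\<^sub>C a)"
proof -
  have "unit_elt (z *\<^sub>C ((1 / z) *\<^sub>C 1 - a))"
    using assms by (intro unit_elt_scaleC) (auto simp: mem_spectrum_iff)
  then show ?thesis using assms(1) by (simp add: scaleC_diff_right scaleC_scaleC)
qed

lemma spectrum_norm_le:
  fixes a :: "'a::cstar_algebra"
  assumes "z \<in> spectrum a"
  shows "cmod z \<le> norm a"
proof (rule ccontr)
  assume *: "\<not> ?thesis"
  then have z: "z \<noteq> 0" "norm a < cmod z" using norm_ge_zero[of a] by (auto simp: not_le simp del: norm_ge_zero)
  have "norm ((1 / z) *\<^sub>C a) < 1" using z by (simp add: norm_scaleC norm_divide divide_simps)
  then have "unit_elt (z *\<^sub>C (1 - (1 / z) *\<^sub>C a))"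
    by (intro unit_elt_scaleC z unit_elt_one_minus)
  then show False using assms z by (simp add: scaleC_diff_right scaleC_scaleC mem_spectrum_iff)
qed

lemma spectrum_shift:
  fixes a :: "'a::cstar_algebra"
  shows "z \<in> spectrum (c *\<^sub>C 1 - a) \<longleftrightarrow> c - z \<in> spectrum a"
proof -
  have "z *\<^sub>C 1 - (c *\<^sub>C 1 - a) = - ((c - z) *\<^sub>C 1 - a)"
    by (simp add: scaleC_diff_left)
  then show ?thesis by (simp only: mem_spectrum_iff unit_elt_uminus_iff)
qed

lemma spectrum_add_scalar:
  fixes a :: "'a::cstar_algebra"
  shows "z \<in> spectrum (a + c *\<^sub>C 1) \<longleftrightarrow> z - c \<in> spectrum a"
proof -
  have "z *\<^sub>C 1 - (a + c *\<^sub>C 1) = (z - c) *\<^sub>C 1 - a"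
    by (simp add: scaleC_diff_left algebra_simps)
  then show ?thesis by (simp only: mem_spectrum_iff)
qed

text \<open>
  If \<open>x + \<i> y\<close> lies in the spectrum of \<open>a\<close>, then adding the scalar \<open>\<i> l\<close> moves it to \<open>x + \<i> (y + l)\<close>, while by the
  C*-identity the squared norm of \<open>a + \<i> l\<close> is at most \<open>(norm a)\<^sup>2 + l\<^sup>2\<close>. Hence \<open>x\<^sup>2 + y\<^sup>2 + 2 y l\<close> stays bounded for
  all real \<open>l\<close>, which forces \<open>y = 0\<close>.
\<close>

lemma self_adjoint_spectrum_real:
  fixes a :: "'a::cstar_algebra"
  assumes "star a = a" "z \<in> spectrum a"
  shows "z \<in> \<real>"
proof -
  have bound: "(Re z)\<^sup>2 + (Im z)\<^sup>2 + 2 * Im z * l \<le> (norm a)\<^sup>2" for l :: real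
  proof -
    let ?b = "a + (\<i> * l) *\<^sub>C 1"
    have "z + \<i> * l \<in> spectrum ?b" using assms(2) by (simp add: spectrum_add_scalar)
    then have "(cmod (z + \<i> * l))\<^sup>2 \<le> (norm ?b)\<^sup>2"
      by (intro power_mono spectrum_norm_le) simp_all
    also have "\<dots> = norm (star ?b * ?b)" by (simp add: cstar_identity)
    also have "star ?b * ?b = a * a + (l\<^sup>2) *\<^sub>R 1"
      by (simp add: star_add star_scaleC assms(1) algebra_simps mult_scaleC_left mult_scaleC_right
          scaleC_scaleC scaleC_minus_left scaleC_diff_right scaleR_eq_scaleC power2_eq_square)
    also have "norm \<dots> \<le> norm a * norm a + l\<^sup>2"
      by (intro norm_triangle_le add_mono norm_mult_ineq) simp
    finally have "(Re z)\<^sup>2 + (Im z + l)\<^sup>2 \<le> norm a * norm a + l\<^sup>2"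
      unfolding cmod_power2 by simp
    then show ?thesis by (simp add: power2_eq_square algebra_simps)
  qed
  have "Im z = 0"
  proof (rule ccontr)
    assume "Im z \<noteq> 0"
    then have "2 * Im z * (((norm a)\<^sup>2 + 1) / (2 * Im z)) = (norm a)\<^sup>2 + 1" by simp
    then show False
      using bound[of "((norm a)\<^sup>2 + 1) / (2 * Im z)"] zero_le_power2[of "Re z"] zero_le_power2[of "Im z"]
      by linarith
  qed
  then show ?thesis by (simp add: complex_is_Real_iff)
qed

text \<open>
  Only exponents that are powers of two are treated: they are exactly those that repeated squaring, that
  is the C*-identity, reaches.
\<close>

lemma norm_self_adjoint_power:
  fixes h :: "'a::cstar_algebra"
  assumes "star h = h"
  shows "norm (h ^ (2 ^ k)) = norm h ^ (2 ^ k)"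
proof (induction k)
  case (Suc k)
  have "norm (h ^ (2 ^ Suc k)) = norm (star (h ^ (2 ^ k)) * h ^ (2 ^ k))"
    by (simp add: star_power assms power_mult power2_eq_square mult.commute flip: power_add mult_2)
  also have "\<dots> = norm h ^ (2 ^ Suc k)"
    by (simp only: cstar_identity Suc.IH) (simp add: mult.commute flip: power_mult)
  finally show ?case .
qed simp


section \<open>Norm and spectrum of self-adjoint elements\<close>

text \<open>
  The constants of this lemma and the next are tuned to each other. A perturbation of the inverse of size
  at most \<open>1 / 9\<close> turns the bound \<open>1 / 9\<close> into \<open>2 / 9\<close>, and \<open>2 / 9\<close> is small enough (any number below \<open>1 / 2\<close> is)
  to keep \<open>norm u\<close> below 1.
\<close>

lemma left_inverse_near_one:
  fixes u y :: "'a::real_normed_algebra_1"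
  assumes "y * (1 - u) = 1" "norm u \<le> 1 / 10"
  shows "norm (y - 1) \<le> 1 / 9"
proof -
  have e: "y - 1 = y * u" using assms(1) by (simp add: algebra_simps)
  have yu: "norm (y * u) \<le> norm y / 10"
    using order_trans[OF norm_mult_ineq mult_left_mono[OF assms(2), of "norm y"]] by simp
  have "norm y \<le> 1 + norm (y - 1)" using norm_triangle_ineq[of 1 "y - 1"] by simp
  then show ?thesis using yu unfolding e by linarith
qed

lemma norm_less_one_of_left_inverse_near_one:
  fixes u x :: "'a::real_normed_algebra_1"
  assumes "x * (1 - u) = 1" "norm (x - 1) \<le> 2 / 9"
  shows "norm u < 1"
proof (rule ccontr)
  assume "\<not> ?thesis"
  then have u: "norm u \<ge> 1" by simp
  have "u = (x - 1) - (x - 1) * u" using assms(1) by (simp add: algebra_simps)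
  then have "norm u \<le> norm (x - 1) + norm (x - 1) * norm u"
    by (metis norm_mult_ineq norm_triangle_ineq4 add_left_mono order_trans)
  also have "\<dots> \<le> 2 / 9 + 2 / 9 * norm u"
    by (intro add_mono mult_right_mono assms) simp
  finally show False using u by simp
qed

text \<open>
  The resolvent identity \<open>V z - V w = (z - w) V z h V w\<close> bounds \<open>norm (V z)\<close> by \<open>2 * norm (V w)\<close> as soon as \<open>z\<close> is
  so close to \<open>w\<close> that \<open>cmod (z - w) * norm h * norm (V w) \<le> 1 / 2\<close>, and then gives a Lipschitz estimate at \<open>w\<close>.
\<close>

lemma resolvent_continuous_on:
  fixes h :: "'a::cstar_algebra"
  assumes V: "\<And>z. z \<in> S \<Longrightarrow> V z * (1 - z *\<^sub>C h) = 1" "\<And>z. z \<in> S \<Longrightarrow> (1 - z *\<^sub>C h) * V z = 1"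
  shows "continuous_on S V"
  unfolding continuous_on_iff
proof (intro ballI allI impI)
  fix w and e :: real
  assume w: "w \<in> S" and e: "e > 0"
  define c where "c = norm h * norm (V w)"
  define d where "d = min (1 / (2 * (c + 1))) (e / (2 * c * norm (V w) + 1))"
  have c: "c \<ge> 0" by (simp add: c_def)
  have d: "d > 0" using e c by (auto simp: d_def add_nonneg_pos)
  have "dist (V z) (V w) < e" if z: "z \<in> S" "dist z w < d" for z
  proof -
    have "V z - V w = V z * ((1 - w *\<^sub>C h) - (1 - z *\<^sub>C h)) * V w"
    proof -
      have "V z - V w = V z * ((1 - w *\<^sub>C h) * V w) - (V z * (1 - z *\<^sub>C h)) * V w"
        by (simp only: V z w mult_1_left mult_1_right)
      then show ?thesis by (simp only: left_diff_distrib right_diff_distrib mult.assoc)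
    qed
    also have "\<dots> = V z * ((z - w) *\<^sub>C h) * V w" by (simp add: scaleC_diff_left)
    also have "norm \<dots> \<le> norm (V z) * norm ((z - w) *\<^sub>C h) * norm (V w)"
      by (intro order_trans[OF norm_mult_ineq] mult_right_mono norm_mult_ineq) simp
    finally have "norm (V z - V w) \<le> norm (V z) * (cmod (z - w) * norm h) * norm (V w)"
      by (simp only: norm_scaleC)
    then have *: "norm (V z - V w) \<le> norm (V z) * (cmod (z - w) * c)" by (simp add: c_def mult.assoc)
    have dz: "cmod (z - w) < d" using z by (simp add: dist_norm)
    have "cmod (z - w) * c \<le> d * (c + 1)" using dz c d by (intro mult_mono) auto
    also have "\<dots> \<le> (1 / (2 * (c + 1))) * (c + 1)" using c by (intro mult_right_mono) (auto simp: d_def)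
    also have "\<dots> = 1 / 2" using c by simp
    finally have half: "norm (V z) * (cmod (z - w) * c) \<le> norm (V z) * (1 / 2)"
      by (intro mult_left_mono) auto
    have "norm (V z) \<le> norm (V w) + norm (V z - V w)" by (metis norm_triangle_sub)
    then have "norm (V z) \<le> 2 * norm (V w)" using * half by simp
    then have "norm (V z - V w) \<le> (2 * norm (V w)) * (cmod (z - w) * c)"
      using c by (intro order_trans[OF *] mult_right_mono) auto
    also have "\<dots> = cmod (z - w) * (2 * c * norm (V w))" by simp
    also have "\<dots> \<le> d * (2 * c * norm (V w))" using dz c by (intro mult_right_mono) auto
    also have "\<dots> < d * (2 * c * norm (V w) + 1)" using d by simp
    also have "\<dots> \<le> (e / (2 * c * norm (V w) + 1)) * (2 * c * norm (V w) + 1)"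
      using c by (intro mult_right_mono) (auto simp: d_def)
    also have "\<dots> = e" using c by (simp add: add_nonneg_eq_0_iff)
    finally show ?thesis by (simp add: dist_norm)
  qed
  then show "\<exists>d>0. \<forall>x'\<in>S. dist x' w < d \<longrightarrow> dist (V x') (V w) < e" using d by blast
qed

text \<open>
  The mean of \<open>V\<close> over the points \<open>\<omega> z\<close> with \<open>\<omega>\<close> running through the roots of unity of order \<open>2 ^ k\<close>.
\<close>

primrec dyadic_average :: "(complex \<Rightarrow> 'a::real_vector) \<Rightarrow> nat \<Rightarrow> complex \<Rightarrow> 'a" where
  "dyadic_average V 0 z = V z"
| "dyadic_average V (Suc k) z =
     (1 / 2) *\<^sub>R (dyadic_average V k z + dyadic_average V k (cis (pi / 2 ^ k) * z))"

text \<open>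
  The mean over roots of unity of the inverses of \<open>1 - \<omega> z h\<close> inverts \<open>1 - (z h) ^ N\<close> for \<open>N = 2 ^ k\<close>. The doubling
  step is the partial fraction identity that writes the inverse of \<open>1 - u * u\<close> as the mean of the inverses of
  \<open>1 - u\<close> and \<open>1 + u\<close>.
\<close>

lemma dyadic_average_left_inverse:
  fixes h :: "'a::cstar_algebra"
  assumes V: "\<And>z. cmod z \<le> s \<Longrightarrow> V z * (1 - z *\<^sub>C h) = 1" and z: "cmod z \<le> s"
  shows "dyadic_average V k z * (1 - (z ^ 2 ^ k) *\<^sub>C h ^ 2 ^ k) = 1"
  using z
proof (induction k arbitrary: z)
  case 0
  then show ?case by (simp add: V)
next
  case (Suc k)
  let ?w = "cis (pi / 2 ^ k) * z"
  define u where "u = (z ^ 2 ^ k) *\<^sub>C h ^ 2 ^ k"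
  define P Q where "P = dyadic_average V k z" and "Q = dyadic_average V k ?w"
  have "cis (pi / 2 ^ k) ^ 2 ^ k = cis pi" by (simp only: Complex.DeMoivre) simp
  then have "?w ^ 2 ^ k = - (z ^ 2 ^ k)" by (simp add: power_mult_distrib)
  then have P: "P * (1 - u) = 1" and Q: "Q * (1 + u) = 1"
    using Suc.IH[of z] Suc.IH[of ?w] Suc.prems
    by (simp_all add: P_def Q_def u_def norm_mult scaleC_minus_left)
  have uu: "(z ^ 2 ^ Suc k) *\<^sub>C h ^ 2 ^ Suc k = u * u"
    by (simp add: u_def mult_scaleC_left mult_scaleC_right scaleC_scaleC mult_2 power_add)
  have "P * (1 - u * u) = P * (1 - u) * (1 + u)" by (simp add: algebra_simps)
  also have "\<dots> = 1 + u" by (simp add: P)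
  finally have 1: "P * (1 - u * u) = 1 + u" .
  have "Q * (1 - u * u) = Q * (1 + u) * (1 - u)" by (simp add: algebra_simps)
  also have "\<dots> = 1 - u" by (simp add: Q)
  finally have 2: "Q * (1 - u * u) = 1 - u" .
  have "dyadic_average V (Suc k) z * (1 - u * u) = (1 / 2) *\<^sub>R (P * (1 - u * u) + Q * (1 - u * u))"
    by (simp add: P_def Q_def distrib_right)
  also have "\<dots> = 1" unfolding 1 2 by (simp flip: scaleR_2)
  finally show ?case unfolding uu .
qed

text \<open>
  Rotations preserve the disc and all distances, so the modulus of continuity survives the averaging
  with the same constants for every \<open>k\<close>. This uniformity in \<open>k\<close> is what the next theorem rests on.
\<close>

lemma dyadic_average_dist_le:
  fixes V :: "complex \<Rightarrow> 'a::real_normed_vector"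
  assumes V: "\<And>z w. cmod z \<le> s \<Longrightarrow> cmod w \<le> s \<Longrightarrow> cmod (z - w) < d \<Longrightarrow> norm (V z - V w) \<le> e"
    and z: "cmod z \<le> s" "cmod w \<le> s" "cmod (z - w) < d"
  shows "norm (dyadic_average V k z - dyadic_average V k w) \<le> e"
  using z
proof (induction k arbitrary: z w)
  case (Suc k)
  let ?c = "cis (pi / 2 ^ k)" and ?D = "dyadic_average V k"
  have "cmod (?c * z - ?c * w) < d"
    using Suc.prems by (simp add: norm_mult flip: right_diff_distrib)
  then have "norm (?D (?c * z) - ?D (?c * w)) \<le> e"
    using Suc.prems by (intro Suc.IH) (simp_all add: norm_mult)
  moreover have "norm (?D z - ?D w) \<le> e" using Suc by blast
  moreover have "dyadic_average V (Suc k) z - dyadic_average V (Suc k) w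
      = (1 / 2) *\<^sub>R ((?D z - ?D w) + (?D (?c * z) - ?D (?c * w)))"
    by (simp add: algebra_simps)
  ultimately show ?case
    by (simp only: norm_scaleR) (use norm_triangle_ineq[of "?D z - ?D w" "?D (?c * z) - ?D (?c * w)"] in simp)
qed (simp add: V)

text \<open>
  The spectral radius formula for self-adjoint elements, by Rickart's argument with roots of unity.
  Suppose \<open>norm h > r\<close>. Then \<open>1 - z h\<close> is invertible on the closed
  disc of radius \<open>1 / norm h\<close>, with a uniformly continuous inverse \<open>V\<close>. The averages of \<open>V\<close> invert \<open>1 - (z h) ^ N\<close>
  and inherit the modulus of continuity, whatever \<open>N\<close> is. At a point \<open>w\<close> just inside the disc \<open>(w h) ^ N\<close> tends to
  zero, so the average there is near 1, hence so is the average at the boundary point \<open>z = 1 / norm h\<close>. But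
  \<open>(z h) ^ N\<close> has norm exactly 1 when \<open>N\<close> is a power of two, which is a contradiction.
\<close>

theorem norm_le_of_spectrum_bound:
  fixes h :: "'a::cstar_algebra"
  assumes sa: "star h = h" and r: "\<And>z. z \<in> spectrum h \<Longrightarrow> cmod z \<le> r" "0 \<le> r"
  shows "norm h \<le> r"
proof (rule ccontr)
  assume "\<not> ?thesis"
  then have hr: "r < norm h" by simp
  then have h: "norm h > 0" using r(2) by linarith
  let ?s = "1 / norm h"
  have "\<exists>v. v * (1 - z *\<^sub>C h) = 1 \<and> (1 - z *\<^sub>C h) * v = 1" if z: "cmod z \<le> ?s" for z
  proof (cases "z = 0")
    case False
    have "cmod (1 / z) \<ge> norm h" using z False h by (simp add: norm_divide field_simps)
    then have "1 / z \<notin> spectrum h" using r(1) hr by force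
    from unit_elt_one_minus_scaleC[OF False this] show ?thesis by (simp add: unit_elt_def)
  qed auto
  then obtain V where V: "\<And>z. cmod z \<le> ?s \<Longrightarrow> V z * (1 - z *\<^sub>C h) = 1"
      "\<And>z. cmod z \<le> ?s \<Longrightarrow> (1 - z *\<^sub>C h) * V z = 1"
    by metis
  have "uniformly_continuous_on (cball 0 ?s) V"
    by (intro compact_uniformly_continuous compact_cball resolvent_continuous_on[where h = h])
      (simp_all add: V)
  then obtain d where d: "d > 0"
    "\<And>z w. z \<in> cball 0 ?s \<Longrightarrow> w \<in> cball 0 ?s \<Longrightarrow> dist w z < d \<Longrightarrow> dist (V w) (V z) < 1 / 9"
    unfolding uniformly_continuous_on_def by (metis zero_less_divide_1_iff zero_less_numeral)
  have Vd: "norm (V z - V w) \<le> 1 / 9" if "cmod z \<le> ?s" "cmod w \<le> ?s" "cmod (z - w) < d" for z w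
    using d(2)[of w z] that by (simp add: dist_norm)
  \<comment> \<open>The point \<open>t / norm h\<close> has distance less than \<open>d\<close> from the boundary point \<open>1 / norm h\<close>; the maximum keeps
    \<open>t\<close> positive.\<close>
  define t where "t = max (1 / 2) (1 - d * norm h / 2)"
  have t: "0 < t" "t < 1" using d h by (auto simp: t_def)
  obtain n where n: "t ^ n < 1 / 10" using real_arch_pow_inv[of "1 / 10" t] t by auto
  define N :: nat where "N = 2 ^ n"
  have "t ^ N \<le> t ^ n" unfolding N_def using t by (intro power_decreasing) auto
  with n have tN: "t ^ N \<le> 1 / 10" by simp
  define z w where "z = complex_of_real ?s" and "w = complex_of_real (t * ?s)"
  have z: "cmod z \<le> ?s" using h by (simp add: z_def norm_divide)
  have w: "cmod w \<le> ?s" using h t by (simp add: w_def norm_mult norm_divide field_simps)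
  have "z - w = complex_of_real ((1 - t) * ?s)"
    unfolding z_def w_def by (simp only: left_diff_distrib of_real_diff mult_1_left)
  then have "cmod (z - w) = (1 - t) * ?s" using h t by (simp only: norm_of_real) simp
  also have "\<dots> \<le> (d * norm h / 2) * ?s" using h by (intro mult_right_mono) (simp_all add: t_def max_def)
  also have "\<dots> < d" using h d by simp
  finally have zw: "cmod (z - w) < d" .
  have nu: "norm ((x ^ N) *\<^sub>C h ^ N) = (cmod x * norm h) ^ N" for x
    unfolding N_def by (simp add: norm_scaleC norm_self_adjoint_power[OF sa] norm_power power_mult_distrib)
  let ?X = "dyadic_average V n z" and ?Y = "dyadic_average V n w"
  have "norm (?Y - 1) \<le> 1 / 9"
  proof (rule left_inverse_near_one)
    show "?Y * (1 - (w ^ N) *\<^sub>C h ^ N) = 1"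
      unfolding N_def by (rule dyadic_average_left_inverse[OF V(1) w])
    show "norm ((w ^ N) *\<^sub>C h ^ N) \<le> 1 / 10"
      unfolding nu using tN t h by (simp add: w_def norm_mult norm_divide)
  qed
  moreover have "norm (?X - ?Y) \<le> 1 / 9"
    by (rule dyadic_average_dist_le[OF Vd z w zw])
  ultimately have "norm (?X - 1) \<le> 2 / 9"
    using norm_triangle_ineq[of "?X - ?Y" "?Y - 1"] by simp
  moreover have "?X * (1 - (z ^ N) *\<^sub>C h ^ N) = 1"
    unfolding N_def by (rule dyadic_average_left_inverse[OF V(1) z])
  ultimately have "norm ((z ^ N) *\<^sub>C h ^ N) < 1"
    by (intro norm_less_one_of_left_inverse_near_one)
  then show False unfolding nu using h by (simp add: z_def norm_divide)
qed

section \<open>The positive cone\<close>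

text \<open>
  This criterion and its converse \<open>cstar_positive_norm_diff\<close> replace the spectral definition of positivity by
  a norm inequality, which is visibly stable under sums, limits and integrals.
\<close>

lemma cstar_positiveI_norm:
  assumes "star a = a" "norm (t *\<^sub>R 1 - a) \<le> t"
  shows "cstar_positive a"
  unfolding cstar_positive_def
proof (intro conjI subsetI)
  fix z assume z: "z \<in> spectrum a"
  then have "z \<in> \<real>" by (rule self_adjoint_spectrum_real[OF assms(1)])
  then obtain x where x: "z = complex_of_real x" by (rule Reals_cases)
  have "complex_of_real t - z \<in> spectrum (complex_of_real t *\<^sub>C 1 - a)"
    using z by (simp add: spectrum_shift)
  then have "cmod (complex_of_real (t - x)) \<le> t"
    using spectrum_norm_le assms(2) unfolding x by (fastforce simp: scaleR_eq_scaleC)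
  then have "x \<ge> 0" unfolding norm_of_real by linarith
  then show "z \<in> \<real>\<^sub>\<ge>\<^sub>0" by (simp add: x)
qed (fact assms)

lemma cstar_positive_star: "cstar_positive a \<Longrightarrow> star a = a"
  by (simp add: cstar_positive_def)

lemma cstar_positive_spectrum:
  assumes "cstar_positive a" "z \<in> spectrum a"
  obtains x where "x \<ge> 0" "x \<le> norm a" "z = complex_of_real x"
proof -
  have "z \<in> \<real>\<^sub>\<ge>\<^sub>0" using assms by (auto simp: cstar_positive_def)
  then obtain x where x: "x \<ge> 0" "z = complex_of_real x" by (auto elim: nonneg_Reals_cases)
  moreover have "x \<le> norm a" using spectrum_norm_le[OF assms(2)] x by simp
  ultimately show ?thesis using that by blast
qed

text \<open>
  The spectrum of \<open>t - a\<close> lies in the interval from \<open>0\<close> to \<open>t\<close>, and its bound controls the norm of this self-adjoint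
  element.
\<close>

lemma cstar_positive_norm_diff:
  assumes a: "cstar_positive a" and t: "norm a \<le> t"
  shows "norm (t *\<^sub>R 1 - a) \<le> t"
proof (rule norm_le_of_spectrum_bound)
  show "star (t *\<^sub>R 1 - a) = t *\<^sub>R 1 - a"
    by (simp add: star_diff star_scaleR cstar_positive_star[OF a])
  show "0 \<le> t" using norm_ge_zero t by (rule order_trans)
  fix z assume "z \<in> spectrum (t *\<^sub>R 1 - a)"
  then have "complex_of_real t - z \<in> spectrum a" by (simp add: spectrum_shift scaleR_eq_scaleC)
  then obtain x where x: "x \<ge> 0" "x \<le> norm a" "complex_of_real t - z = complex_of_real x"
    by (rule cstar_positive_spectrum[OF a])
  then have "z = complex_of_real (t - x)" by (simp add: algebra_simps)
  then show "cmod z \<le> t" using x t by (simp only: norm_of_real)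
qed

lemma cstar_positive_add:
  assumes "cstar_positive a" "cstar_positive b"
  shows "cstar_positive (a + b)"
proof (rule cstar_positiveI_norm[where t = "norm a + norm b"])
  show "star (a + b) = a + b" by (simp add: star_add cstar_positive_star assms)
  have "norm ((norm a *\<^sub>R 1 - a) + (norm b *\<^sub>R 1 - b)) \<le> norm a + norm b"
    by (intro norm_triangle_le add_mono cstar_positive_norm_diff assms order_refl)
  then show "norm ((norm a + norm b) *\<^sub>R 1 - (a + b)) \<le> norm a + norm b"
    by (simp add: algebra_simps)
qed

lemma cstar_positive_scaleR:
  assumes a: "cstar_positive a" and r: "0 \<le> r"
  shows "cstar_positive (r *\<^sub>R a)"
proof (rule cstar_positiveI_norm[where t = "r * norm a"])
  have "(r * norm a) *\<^sub>R 1 - r *\<^sub>R a = r *\<^sub>R (norm a *\<^sub>R 1 - a)" by (simp add: scaleR_diff_right)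
  then show "norm ((r * norm a) *\<^sub>R 1 - r *\<^sub>R a) \<le> r * norm a"
    using r mult_left_mono[OF cstar_positive_norm_diff[OF a order_refl] r] by simp
qed (simp add: star_scaleR cstar_positive_star[OF a])

lemma cstar_positive_norm_minus:
  assumes "star a = a" "norm a \<le> t"
  shows "cstar_positive (t *\<^sub>R 1 - a)"
  by (rule cstar_positiveI_norm[of _ t]) (simp_all add: star_diff star_scaleR assms)

lemma cstar_positive_limit:
  assumes a: "\<And>n. cstar_positive (a n)" and l: "a \<longlonglongrightarrow> l"
  shows "cstar_positive l"
proof (rule cstar_positiveI_norm[where t = "norm l"])
  have "(\<lambda>n. star (a n)) \<longlonglongrightarrow> star l"
    by (rule bounded_linear.tendsto[OF bounded_linear_star l])
  then show "star l = l" using l LIMSEQ_unique by (simp add: cstar_positive_star[OF a])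
  have "(\<lambda>n. norm (norm (a n) *\<^sub>R 1 - a n)) \<longlonglongrightarrow> norm (norm l *\<^sub>R 1 - l)"
    by (intro tendsto_intros l)
  then show "norm (norm l *\<^sub>R 1 - l) \<le> norm l"
    by (rule LIMSEQ_le[OF _ tendsto_norm[OF l]]) (auto intro: cstar_positive_norm_diff a)
qed

lemma norm_le_of_le_scalar:
  assumes a: "cstar_positive a" and t: "cstar_positive (t *\<^sub>R 1 - a)" "0 \<le> t"
  shows "norm a \<le> t"
proof (rule norm_le_of_spectrum_bound)
  fix z assume z: "z \<in> spectrum a"
  then obtain x where x: "x \<ge> 0" "z = complex_of_real x"
    by (rule cstar_positive_spectrum[OF a])
  from z have "complex_of_real t - z \<in> spectrum (t *\<^sub>R 1 - a)" by (simp add: spectrum_shift scaleR_eq_scaleC)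
  then obtain y where "y \<ge> 0" "complex_of_real t - z = complex_of_real y"
    by (rule cstar_positive_spectrum[OF t(1)])
  then have "t - x = y" using x by (metis of_real_diff of_real_eq_iff)
  then show "cmod z \<le> t" using x \<open>y \<ge> 0\<close> by simp
qed (use t in \<open>simp_all add: cstar_positive_star[OF a]\<close>)

lemma cstar_positive_norm_mono:
  assumes a: "cstar_positive a" and ab: "cstar_positive (b - a)"
  shows "norm a \<le> norm b"
proof (rule norm_le_of_le_scalar[OF a])
  have "star b = b" using cstar_positive_star[OF a] cstar_positive_star[OF ab] by (simp add: star_diff)
  then have "cstar_positive ((norm b *\<^sub>R 1 - b) + (b - a))"
    by (intro cstar_positive_add cstar_positive_norm_minus ab) simp_all
  then show "cstar_positive (norm b *\<^sub>R 1 - a)" by simp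
qed simp

lemma unit_elt_positive_add_scalar:
  assumes "cstar_positive a" "\<delta> > 0"
  shows "unit_elt (a + \<delta> *\<^sub>R 1)"
proof -
  have "- complex_of_real \<delta> \<notin> spectrum a"
  proof
    assume "- complex_of_real \<delta> \<in> spectrum a"
    then obtain x where "x \<ge> 0" "- complex_of_real \<delta> = complex_of_real x"
      by (rule cstar_positive_spectrum[OF assms(1)])
    then have "- \<delta> = x" by (metis of_real_minus of_real_eq_iff)
    then show False using assms(2) \<open>x \<ge> 0\<close> by simp
  qed
  moreover have "- (a + \<delta> *\<^sub>R 1) = (- complex_of_real \<delta>) *\<^sub>C 1 - a"
    by (simp add: scaleR_eq_scaleC scaleC_minus_left)
  ultimately have "unit_elt (- (a + \<delta> *\<^sub>R 1))" by (simp only: mem_spectrum_iff not_not)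
  then show ?thesis by (simp only: unit_elt_uminus_iff)
qed

text \<open>
  The points of the spectrum near zero would be invertibility failures of a small perturbation of the
  invertible element \<open>a\<close>; the spectrum therefore starts at some \<open>\<delta> > 0\<close>.
\<close>

lemma positive_unit_bounded_below:
  assumes a: "cstar_positive a" and u: "unit_elt a"
  obtains \<delta> where "\<delta> > 0" "cstar_positive (a - \<delta> *\<^sub>R 1)"
proof -
  obtain c where c: "c * a = 1" "a * c = 1" using u unfolding unit_elt_def by blast
  define \<delta> where "\<delta> = 1 / (norm c + 1)"
  have \<delta>: "\<delta> > 0" "\<delta> * norm c < 1" by (auto simp: \<delta>_def divide_simps add_nonneg_pos)
  have "cstar_positive (a - \<delta> *\<^sub>R 1)"
    unfolding cstar_positive_def
  proof (intro conjI subsetI)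
    show "star (a - \<delta> *\<^sub>R 1) = a - \<delta> *\<^sub>R 1" by (simp add: star_diff star_scaleR cstar_positive_star[OF a])
    fix z assume "z \<in> spectrum (a - \<delta> *\<^sub>R 1)"
    moreover have "a - \<delta> *\<^sub>R 1 = a + (- complex_of_real \<delta>) *\<^sub>C 1"
      by (simp add: scaleR_eq_scaleC scaleC_minus_left)
    ultimately have s: "z + \<delta> \<in> spectrum a" by (simp add: spectrum_add_scalar)
    then obtain x where x: "x \<ge> 0" "z + \<delta> = complex_of_real x"
      by (rule cstar_positive_spectrum[OF a])
    have "x \<ge> \<delta>"
    proof (rule ccontr)
      assume "\<not> ?thesis"
      then have "x * norm c < 1" using \<delta> by (meson le_less_trans mult_right_mono norm_ge_zero not_le less_imp_le)
      then have "unit_elt (1 - x *\<^sub>R c)" using x(1) by (intro unit_elt_one_minus) simp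
      then have "unit_elt (- (a * (1 - x *\<^sub>R c)))" using u by (simp only: unit_elt_uminus_iff) (rule unit_elt_mult)
      moreover have "- (a * (1 - x *\<^sub>R c)) = (z + \<delta>) *\<^sub>C 1 - a"
        unfolding x(2) by (simp add: right_diff_distrib c scaleR_eq_scaleC[symmetric])
      ultimately show False using s by (simp add: mem_spectrum_iff)
    qed
    moreover have "z = complex_of_real (x - \<delta>)" using x(2) by (simp add: algebra_simps)
    ultimately show "z \<in> \<real>\<^sub>\<ge>\<^sub>0" by (simp only: nonneg_Reals_of_real_iff diff_ge_0_iff_ge)
  qed
  with \<delta>(1) show ?thesis by (rule that)
qed

lemma unit_elt_positive_add:
  assumes a: "cstar_positive a" "unit_elt a" and b: "cstar_positive b"
  shows "unit_elt (b + a)"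
proof -
  obtain \<delta> where \<delta>: "\<delta> > 0" "cstar_positive (a - \<delta> *\<^sub>R 1)" using positive_unit_bounded_below[OF a] .
  have "unit_elt ((b + (a - \<delta> *\<^sub>R 1)) + \<delta> *\<^sub>R 1)"
    by (intro unit_elt_positive_add_scalar cstar_positive_add b \<delta>)
  then show ?thesis by simp
qed

lemma cstar_positiveI_unit:
  assumes sa: "star a = a" and u: "\<And>\<mu>. \<mu> > 0 \<Longrightarrow> unit_elt (a + \<mu> *\<^sub>R 1)"
  shows "cstar_positive a"
  unfolding cstar_positive_def
proof (intro conjI subsetI)
  fix z assume z: "z \<in> spectrum a"
  then have "z \<in> \<real>" by (rule self_adjoint_spectrum_real[OF sa])
  then obtain x where x: "z = complex_of_real x" by (rule Reals_cases)
  have "x \<ge> 0"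
  proof (rule ccontr)
    assume "\<not> ?thesis"
    then have "unit_elt (- (a + (- x) *\<^sub>R 1))" unfolding unit_elt_uminus_iff by (intro u) simp
    then show False using z by (simp add: mem_spectrum_iff x scaleC_of_real)
  qed
  then show "z \<in> \<real>\<^sub>\<ge>\<^sub>0" by (simp add: x)
qed (fact sa)

text \<open>
  For \<open>\<mu> > 0\<close> the element \<open>b * b + \<mu>\<close> factors as \<open>(b + \<i> \<surd>\<mu>) (b - \<i> \<surd>\<mu>)\<close>, and both factors are
  invertible because the spectrum of \<open>b\<close> is real.
\<close>

lemma cstar_positive_square:
  fixes b :: "'a::cstar_algebra"
  assumes sa: "star b = b"
  shows "cstar_positive (b * b)"
proof (rule cstar_positiveI_unit)
  fix \<mu> :: real assume \<mu>: "\<mu> > 0"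
  define z where "z = \<i> * complex_of_real (sqrt \<mu>)"
  have "z \<notin> \<real>" "- z \<notin> \<real>" using \<mu> by (simp_all add: z_def complex_is_Real_iff)
  then have "unit_elt (z *\<^sub>C 1 - b)" "unit_elt ((- z) *\<^sub>C 1 - b)"
    using self_adjoint_spectrum_real[OF sa] by (meson mem_spectrum_iff)+
  then have "unit_elt (- ((z *\<^sub>C 1 - b) * ((- z) *\<^sub>C 1 - b)) )"
    unfolding unit_elt_uminus_iff by (rule unit_elt_mult)
  moreover have "z * z = - complex_of_real \<mu>"
    using \<mu> by (simp add: z_def algebra_simps flip: of_real_mult)
  then have "- ((z *\<^sub>C 1 - b) * ((- z) *\<^sub>C 1 - b)) = - (b * b + \<mu> *\<^sub>R 1)"
    by (simp add: algebra_simps mult_scaleC_left mult_scaleC_right scaleC_scaleC scaleC_minus_left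
        scaleC_minus_right scaleC_diff_right scaleR_eq_scaleC)
  ultimately show "unit_elt (b * b + \<mu> *\<^sub>R 1)" by (simp only: unit_elt_uminus_iff)
qed (simp add: star_mult sa)

text \<open>
  With \<open>b\<close> the inverse of \<open>d\<close> one has \<open>d u d + \<mu> = d (u + \<mu> b\<^sup>2) d\<close>, and \<open>u + \<mu> b\<^sup>2\<close> is invertible as the sum of a
  positive and an invertible positive element. The inverse of \<open>d\<close> is again self-adjoint, so its square
  is positive.
\<close>

lemma cstar_positive_conjugate:
  fixes u d b :: "'a::cstar_algebra"
  assumes u: "cstar_positive u" and d: "star d = d" and b: "b * d = 1" "d * b = 1"
  shows "cstar_positive (d * u * d)"
proof (rule cstar_positiveI_unit)
  show "star (d * u * d) = d * u * d"
    by (simp add: star_mult cstar_positive_star[OF u] d mult.assoc)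
  fix \<mu> :: real assume \<mu>: "\<mu> > 0"
  have "star b * d = 1" using b(2) d by (metis star_mult star_one)
  then have sb: "star b = b" by (metis b(2) mult.assoc mult_1_left mult_1_right)
  have ud: "unit_elt d" using b by (rule unit_eltI)
  have ub: "unit_elt b" using b(2,1) by (rule unit_eltI)
  have "unit_elt (\<mu> *\<^sub>R (b * b))"
    unfolding scaleR_eq_scaleC using \<mu> ub by (intro unit_elt_scaleC unit_elt_mult) auto
  then have "unit_elt (u + \<mu> *\<^sub>R (b * b))"
    using \<mu> by (intro unit_elt_positive_add u cstar_positive_scaleR cstar_positive_square sb) auto
  then have "unit_elt (d * (u + \<mu> *\<^sub>R (b * b)) * d)" by (intro unit_elt_mult ud)
  moreover have "d * (b * b) * d = (d * b) * (b * d)" by (simp only: mult.assoc)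
  ultimately show "unit_elt (d * u * d + \<mu> *\<^sub>R 1)" by (simp add: algebra_simps b)
qed

section \<open>Inverse square roots\<close>

text \<open>
  The Taylor coefficients of \<open>(1 - t) powr (- 1 / 2)\<close>.
\<close>

definition inv_sqrt_coeff :: "nat \<Rightarrow> real" where
  "inv_sqrt_coeff n = ((- 1 / 2) gchoose n) * (- 1) ^ n"

lemma abs_inv_sqrt_coeff_le_1: "\<bar>inv_sqrt_coeff n\<bar> \<le> 1"
proof (induction n)
  case (Suc n)
  have "((- 1 / 2 :: real) gchoose Suc n) = ((- 1 / 2) gchoose n) * ((- 1 / 2 - real n) / (real n + 1))"
    by (simp add: gbinomial_prod_rev field_simps)
  then have "\<bar>inv_sqrt_coeff (Suc n)\<bar> = \<bar>inv_sqrt_coeff n\<bar> * \<bar>(- 1 / 2 - real n) / (real n + 1)\<bar>"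
    by (simp only: inv_sqrt_coeff_def abs_mult) (simp add: power_abs)
  also have "\<dots> \<le> 1 * 1"
    by (intro mult_mono Suc.IH) (auto simp: field_simps)
  finally show ?case by simp
qed (simp add: inv_sqrt_coeff_def)

text \<open>
  The coefficientwise form of the identity that the square of \<open>(1 - t) powr (- 1 / 2)\<close> is the geometric
  series; it is Vandermonde's convolution.
\<close>

lemma inv_sqrt_coeff_convolution: "(\<Sum>i\<le>n. inv_sqrt_coeff i * inv_sqrt_coeff (n - i)) = 1"
proof -
  have "(\<Sum>i\<le>n. inv_sqrt_coeff i * inv_sqrt_coeff (n - i))
      = (\<Sum>i\<le>n. (((- 1 / 2) gchoose i) * ((- 1 / 2) gchoose (n - i))) * (- 1) ^ n)"
    by (intro sum.cong) (auto simp: inv_sqrt_coeff_def mult_ac simp flip: power_add)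
  also have "\<dots> = (\<Sum>i\<in>{0..n}. ((- 1 / 2) gchoose i) * ((- 1 / 2) gchoose (n - i))) * (- 1) ^ n"
    by (simp add: sum_distrib_right atLeast0AtMost)
  also have "\<dots> = ((- 1) gchoose n) * (- 1) ^ n"
    by (simp only: gbinomial_Vandermonde) simp
  also have "\<dots> = 1"
    by (simp add: gbinomial_minus[of 1, simplified] binomial_gbinomial[symmetric] flip: power_mult_distrib)
  finally show ?thesis .
qed

text \<open>
  The binomial series is inserted into the algebra. It converges absolutely, so its square is the Cauchy
  product, which the convolution identity turns into the geometric series.
\<close>

lemma inverse_square_root_of_one_minus:
  fixes h :: "'a::cstar_algebra"
  assumes sa: "star h = h" and h: "norm h < 1"
  obtains b where "star b = b" "b * h = h * b" "b * b * (1 - h) = 1"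
proof -
  define f where "f n = inv_sqrt_coeff n *\<^sub>R h ^ n" for n
  have "norm (f n) \<le> norm h ^ n" for n
    using mult_mono[OF abs_inv_sqrt_coeff_le_1[of n] norm_power_ineq[of h n]] by (simp add: f_def)
  then have ns: "summable (\<lambda>n. norm (f n))"
    using h by (intro summable_comparison_test'[OF summable_geometric[of "norm h"], of 0]) simp_all
  then have s: "summable f" by (rule summable_norm_cancel)
  define b where "b = suminf f"
  have "star b = (\<Sum>n. star (f n))"
    unfolding b_def by (rule bounded_linear.suminf[OF bounded_linear_star s])
  moreover have "star (f n) = f n" for n by (simp add: f_def star_scaleR star_power sa)
  ultimately have 1: "star b = b" by (simp add: b_def)
  have 2: "b * h = h * b"
    unfolding b_def suminf_mult[OF s, symmetric] suminf_mult2[OF s] by (simp add: f_def power_commutes)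
  have conv: "(\<Sum>i\<le>n. f i * f (n - i)) = h ^ n" for n
  proof -
    have "(\<Sum>i\<le>n. f i * f (n - i)) = (\<Sum>i\<le>n. (inv_sqrt_coeff i * inv_sqrt_coeff (n - i)) *\<^sub>R h ^ n)"
      by (intro sum.cong) (auto simp: f_def mult_ac simp flip: power_add)
    also have "\<dots> = h ^ n" by (simp add: inv_sqrt_coeff_convolution flip: scaleR_sum_left)
    finally show ?thesis .
  qed
  have "b * b = (\<Sum>n. \<Sum>i\<le>n. f i * f (n - i))"
    unfolding b_def by (rule Cauchy_product[OF ns ns])
  then have "b * b = (\<Sum>n. h ^ n)" by (simp only: conv)
  then have "b * b * (1 - h) = 1" using geometric_series_inverse(1)[OF h] by simp
  with 1 2 show ?thesis by (rule that)
qed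

text \<open>
  Here \<open>d\<close> is a square root of \<open>a + \<epsilon>\<close> and \<open>b\<close> is the inverse of \<open>d\<close>. Dividing by \<open>t = norm a + \<epsilon>\<close> writes \<open>a + \<epsilon>\<close> as
  \<open>t (1 - h)\<close> with \<open>norm h < 1\<close>; this is where \<open>\<epsilon> > 0\<close> is used.
\<close>

lemma inverse_square_root:
  fixes a :: "'a::cstar_algebra"
  assumes a: "cstar_positive a" and e: "\<epsilon> > 0"
  obtains b d where "star b = b" "star d = d" "b * d = 1" "d * b = 1" "d * d = a + \<epsilon> *\<^sub>R 1"
proof -
  define t where "t = norm a + \<epsilon>"
  define h where "h = (1 / t) *\<^sub>R (norm a *\<^sub>R 1 - a)"
  have t: "t > 0" using e by (simp add: t_def add_nonneg_pos)
  have sh: "star h = h" by (simp add: h_def star_scaleR star_diff cstar_positive_star[OF a])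
  have "norm h \<le> norm a / t"
    using cstar_positive_norm_diff[OF a order_refl] t by (simp add: h_def divide_right_mono)
  also have "\<dots> < 1" using t e by (simp add: t_def)
  finally have nh: "norm h < 1" .
  obtain c where c: "star c = c" "c * h = h * c" "c * c * (1 - h) = 1"
    using inverse_square_root_of_one_minus[OF sh nh] .
  have ae: "a + \<epsilon> *\<^sub>R 1 = t *\<^sub>R (1 - h)" 
  proof -
    have "t *\<^sub>R (1 - h) = t *\<^sub>R 1 - (norm a *\<^sub>R 1 - a)" using t by (simp add: h_def scaleR_diff_right)
    then show ?thesis by (simp add: t_def scaleR_add_left)
  qed
  have ch: "c * (1 - h) = (1 - h) * c" by (simp add: algebra_simps c(2))
  define b where "b = (1 / sqrt t) *\<^sub>R c"
  define d where "d = sqrt t *\<^sub>R (c * (1 - h))"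
  have st: "sqrt t \<noteq> 0" "sqrt t * sqrt t = t" using t by simp_all
  show ?thesis
  proof (rule that[of b d])
    show "star b = b" by (simp add: b_def star_scaleR c(1))
    show "star d = d" by (simp add: d_def star_scaleR star_mult star_diff sh c(1) ch)
    show bd: "b * d = 1" using st c(3) by (simp add: b_def d_def mult.assoc)
    have "c * (1 - h) * c = 1" unfolding mult.assoc ch[symmetric] using c(3) by (simp add: mult.assoc)
    then show "d * b = 1" using st by (simp add: b_def d_def)
    have "d * d = t *\<^sub>R (c * (1 - h) * (c * (1 - h)))" using st(2) by (simp add: d_def)
    also have "c * (1 - h) * (c * (1 - h)) = c * ((1 - h) * c) * (1 - h)" by (simp only: mult.assoc)
    also have "\<dots> = c * (c * (1 - h)) * (1 - h)" by (simp only: ch)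
    also have "\<dots> = 1 - h" using c(3) by (simp only: mult.assoc[symmetric] mult_1_left)
    finally show "d * d = a + \<epsilon> *\<^sub>R 1" unfolding ae .
  qed
qed

section \<open>From norm inequalities to order inequalities\<close>

text \<open>
  A norm inequality between two positive elements becomes an order inequality once it holds for all their
  conjugates by self-adjoint elements. Conjugating with \<open>b\<close>, the inverse square root of \<open>Q + \<epsilon>\<close>, makes \<open>b Q b\<close> at most 1, hence
  \<open>norm (b P b) \<le> C\<close>, that is \<open>b P b\<close> lies below the scalar \<open>C\<close>. Undoing the conjugation gives \<open>P \<preceq> C (Q + \<epsilon>)\<close>, and
  \<open>\<epsilon>\<close> tends to zero.
\<close>

theorem cstar_le_of_norm_le:
  fixes P Q :: "'a::cstar_algebra"
  assumes P: "cstar_positive P" and Q: "cstar_positive Q" and C: "0 \<le> C"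
    and le: "\<And>b. star b = b \<Longrightarrow> norm (b * P * b) \<le> C * norm (b * Q * b)"
  shows "P \<preceq> C *\<^sub>R Q"
proof -
  have approx: "cstar_positive (C *\<^sub>R (Q + \<epsilon> *\<^sub>R 1) - P)" if e: "\<epsilon> > 0" for \<epsilon>
  proof -
    obtain b d where b: "star b = b" "star d = d" "b * d = 1" "d * b = 1" "d * d = Q + \<epsilon> *\<^sub>R 1"
      using inverse_square_root[OF Q e] .
    have "b * (Q + \<epsilon> *\<^sub>R 1) * b = (b * d) * (d * b)" unfolding b(5)[symmetric] by (simp only: mult.assoc)
    then have bb: "1 - b * Q * b = \<epsilon> *\<^sub>R (b * b)" by (simp add: b algebra_simps)
    have "norm (b * Q * b) \<le> 1"
    proof (rule norm_le_of_le_scalar)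
      show "cstar_positive (b * Q * b)" by (rule cstar_positive_conjugate[OF Q b(1,4,3)])
      show "cstar_positive (1 *\<^sub>R 1 - b * Q * b)"
        using e by (simp add: bb cstar_positive_scaleR cstar_positive_square b)
    qed simp
    then have "norm (b * P * b) \<le> C"
      using le[OF b(1)] mult_left_mono[OF _ C] by fastforce
    moreover have "star (b * P * b) = b * P * b"
      by (simp add: star_mult b cstar_positive_star[OF P] mult.assoc)
    ultimately have "cstar_positive (d * (C *\<^sub>R 1 - b * P * b) * d)"
      by (intro cstar_positive_conjugate[OF _ b(2,3,4)] cstar_positive_norm_minus)
    moreover have "d * (C *\<^sub>R 1 - b * P * b) * d = C *\<^sub>R (d * d) - (d * b) * P * (b * d)"
      by (simp add: algebra_simps)
    ultimately show ?thesis by (simp add: b)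
  qed
  have "(\<lambda>n. C *\<^sub>R (Q + (1 / real (Suc n)) *\<^sub>R 1) - P) \<longlonglongrightarrow> C *\<^sub>R (Q + 0 *\<^sub>R 1) - P"
    by (intro tendsto_intros LIMSEQ_inverse_real_of_nat[unfolded inverse_eq_divide])
  then have "cstar_positive (C *\<^sub>R Q - P)"
    using cstar_positive_limit[of "\<lambda>n. C *\<^sub>R (Q + (1 / real (Suc n)) *\<^sub>R 1) - P"] approx by simp
  then show ?thesis by (simp add: cstar_le_def)
qed

section \<open>Bochner integrals in arbitrary Banach spaces\<close>

lemma strongly_measurable_simple_function:
  "simple_function M s \<Longrightarrow> strongly_measurable M s"
  unfolding strongly_measurable_def by (intro exI[of _ "\<lambda>i. s"]) simp

lemma strongly_measurable_cong_AE:
  assumes "strongly_measurable M f" "AE w in M. f w = g w"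
  shows "strongly_measurable M g"
proof -
  obtain s where s: "\<And>i. simple_function M (s i)" "AE w in M. (\<lambda>i::nat. s i w) \<longlonglongrightarrow> f w"
    using assms(1) unfolding strongly_measurable_def by blast
  have "AE w in M. (\<lambda>i. s i w) \<longlonglongrightarrow> g w" using s(2) assms(2) by eventually_elim simp
  with s(1) show ?thesis unfolding strongly_measurable_def by blast
qed

lemma strongly_measurable_compose2:
  assumes f: "strongly_measurable M f" and g: "strongly_measurable M g"
    and p: "\<And>X Y x y. X \<longlonglongrightarrow> x \<Longrightarrow> Y \<longlonglongrightarrow> y \<Longrightarrow> (\<lambda>i. p (X i) (Y i)) \<longlonglongrightarrow> p x y"
  shows "strongly_measurable M (\<lambda>w. p (f w) (g w))"
proof -
  obtain s where s: "\<And>i. simple_function M (s i)" "AE w in M. (\<lambda>i::nat. s i w) \<longlonglongrightarrow> f w"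
    using f unfolding strongly_measurable_def by blast
  obtain t where t: "\<And>i. simple_function M (t i)" "AE w in M. (\<lambda>i::nat. t i w) \<longlonglongrightarrow> g w"
    using g unfolding strongly_measurable_def by blast
  have "AE w in M. (\<lambda>i. p (s i w) (t i w)) \<longlonglongrightarrow> p (f w) (g w)"
    using s(2) t(2) by eventually_elim (rule p)
  moreover have "simple_function M (\<lambda>w. p (s i w) (t i w))" for i
    by (rule simple_function_compose2[OF s(1) t(1)])
  ultimately show ?thesis unfolding strongly_measurable_def
    by (intro exI[of _ "\<lambda>i w. p (s i w) (t i w)"]) blast
qed

lemma strongly_measurable_compose:
  assumes f: "strongly_measurable M f" and p: "\<And>X x. X \<longlonglongrightarrow> x \<Longrightarrow> (\<lambda>i. p (X i)) \<longlonglongrightarrow> p x"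
  shows "strongly_measurable M (\<lambda>w. p (f w))"
  by (rule strongly_measurable_compose2[OF f f, where p = "\<lambda>x y. p x"]) (rule p)

lemma strongly_measurable_add:
  "strongly_measurable M f \<Longrightarrow> strongly_measurable M g \<Longrightarrow> strongly_measurable M (\<lambda>w. f w + g w)"
  by (rule strongly_measurable_compose2) (auto intro: tendsto_add)

lemma strongly_measurable_diff:
  "strongly_measurable M f \<Longrightarrow> strongly_measurable M g \<Longrightarrow> strongly_measurable M (\<lambda>w. f w - g w)"
  by (rule strongly_measurable_compose2) (auto intro: tendsto_diff)

text \<open>
  Strong measurability only sees \<open>f\<close> up to null sets, so \<open>norm f\<close> itself need not be measurable when the
  measure is incomplete. This measurable version is what additivity of the Lebesgue integral is applied to.
\<close>

lemma strongly_measurable_norm_AE: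
  assumes "strongly_measurable M f"
  obtains h :: "_ \<Rightarrow> real" where "h \<in> borel_measurable M" "AE w in M. norm (f w) = h w"
proof -
  obtain s where s: "\<And>i. simple_function M (s i)" "AE w in M. (\<lambda>i::nat. s i w) \<longlonglongrightarrow> f w"
    using assms unfolding strongly_measurable_def by blast
  show ?thesis
  proof
    have "(\<lambda>w. norm (s i w)) \<in> borel_measurable M" for i
      by (intro borel_measurable_simple_function simple_function_compose1[OF s(1)])
    then show "(\<lambda>w. lim (\<lambda>i. norm (s i w))) \<in> borel_measurable M"
      by (rule borel_measurable_lim_metric)
    show "AE w in M. norm (f w) = lim (\<lambda>i. norm (s i w))"
      using s(2) by eventually_elim (auto intro!: limI[symmetric] tendsto_norm)
  qed
qed

lemma nn_integral_norm_add:
  assumes f: "strongly_measurable M f" and g: "strongly_measurable M g"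
  shows "(\<integral>\<^sup>+w. ennreal (norm (f w) + norm (g w)) \<partial>M) = (\<integral>\<^sup>+w. norm (f w) \<partial>M) + (\<integral>\<^sup>+w. norm (g w) \<partial>M)"
proof -
  obtain h where h: "h \<in> borel_measurable M" "AE w in M. norm (f w) = h w"
    using strongly_measurable_norm_AE[OF f] .
  obtain k where k: "k \<in> borel_measurable M" "AE w in M. norm (g w) = k w"
    using strongly_measurable_norm_AE[OF g] .
  have "(\<integral>\<^sup>+w. ennreal (norm (f w) + norm (g w)) \<partial>M) = (\<integral>\<^sup>+w. ennreal (h w) + ennreal (k w) \<partial>M)"
    by (rule nn_integral_cong_AE) (use h(2) k(2) in eventually_elim, metis ennreal_plus norm_ge_zero)
  also have "\<dots> = (\<integral>\<^sup>+w. ennreal (h w) \<partial>M) + (\<integral>\<^sup>+w. ennreal (k w) \<partial>M)"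
    using h(1) k(1) by (intro nn_integral_add) auto
  also have "(\<integral>\<^sup>+w. ennreal (h w) \<partial>M) = (\<integral>\<^sup>+w. norm (f w) \<partial>M)"
    by (rule nn_integral_cong_AE) (use h(2) in eventually_elim, simp)
  also have "(\<integral>\<^sup>+w. ennreal (k w) \<partial>M) = (\<integral>\<^sup>+w. norm (g w) \<partial>M)"
    by (rule nn_integral_cong_AE) (use k(2) in eventually_elim, simp)
  finally show ?thesis .
qed

lemma nn_integral_norm_le:
  assumes f: "strongly_measurable M f" and g: "strongly_measurable M g"
    and le: "AE w in M. norm (k w) \<le> norm (f w) + norm (g w)"
  shows "(\<integral>\<^sup>+w. norm (k w) \<partial>M) \<le> (\<integral>\<^sup>+w. norm (f w) \<partial>M) + (\<integral>\<^sup>+w. norm (g w) \<partial>M)"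
  unfolding nn_integral_norm_add[OF f g, symmetric]
  by (rule nn_integral_mono_AE) (use le in eventually_elim, rule ennreal_leI)

lemma nn_integral_norm_scaleR:
  assumes f: "strongly_measurable M f" and c: "0 \<le> c"
  shows "(\<integral>\<^sup>+w. c * norm (f w) \<partial>M) = ennreal c * (\<integral>\<^sup>+w. norm (f w) \<partial>M)"
proof -
  obtain h where h: "h \<in> borel_measurable M" "AE w in M. norm (f w) = h w"
    using strongly_measurable_norm_AE[OF f] .
  have "(\<integral>\<^sup>+w. c * norm (f w) \<partial>M) = (\<integral>\<^sup>+w. ennreal c * ennreal (h w) \<partial>M)"
    by (rule nn_integral_cong_AE) (use h(2) in eventually_elim, metis c ennreal_mult norm_ge_zero)
  also have "\<dots> = ennreal c * (\<integral>\<^sup>+w. ennreal (h w) \<partial>M)"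
    using h(1) by (intro nn_integral_cmult) auto
  also have "(\<integral>\<^sup>+w. ennreal (h w) \<partial>M) = (\<integral>\<^sup>+w. norm (f w) \<partial>M)"
    by (rule nn_integral_cong_AE) (use h(2) in eventually_elim, simp)
  finally show ?thesis .
qed

abbreviation (input) "sb_integrable \<equiv> Bochner_Integration.simple_bochner_integrable"
abbreviation (input) "sb_integral \<equiv> Bochner_Integration.simple_bochner_integral"

lemma simple_bochner_integrable_simple_function: "sb_integrable M s \<Longrightarrow> simple_function M s"
  by (rule simple_bochner_integrable.cases)

lemma simple_bochner_integrable_strongly_measurable: "sb_integrable M s \<Longrightarrow> strongly_measurable M s"
  by (intro strongly_measurable_simple_function simple_bochner_integrable_simple_function)

lemma simple_bochner_integral_norm_le_nn_integral:
  assumes "sb_integrable M s"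
  shows "ennreal (norm (sb_integral M s)) \<le> (\<integral>\<^sup>+w. norm (s w) \<partial>M)"
proof -
  have n: "sb_integrable M (\<lambda>w. norm (s w))"
    using simple_bochner_integrable_compose2[of "\<lambda>x y. norm x" M s s] assms by simp
  have "ennreal (norm (sb_integral M s)) \<le> sb_integral M (\<lambda>w. norm (s w))"
    by (intro ennreal_leI simple_bochner_integral_norm_bound assms)
  also have "\<dots> = (\<integral>\<^sup>+w. norm (s w) \<partial>M)" by (rule simple_bochner_integral_eq_nn_integral[OF n]) simp
  finally show ?thesis .
qed

text \<open>
  Two simple functions that are both close to \<open>f\<close> in mean have close integrals. Uniqueness and existence of
  the integral both come from this estimate.
\<close>

lemma simple_bochner_integral_dist_le:
  assumes f: "strongly_measurable M f" and s: "sb_integrable M s" and t: "sb_integrable M t"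
  shows "ennreal (norm (sb_integral M s - sb_integral M t)) \<le> (\<integral>\<^sup>+w. norm (f w - s w) \<partial>M) + (\<integral>\<^sup>+w. norm (f w - t w) \<partial>M)"
proof -
  have st: "sb_integrable M (\<lambda>w. s w - t w)"
    using simple_bochner_integrable_compose2[of "(-)" M s t] s t by simp
  have "ennreal (norm (sb_integral M s - sb_integral M t)) \<le> (\<integral>\<^sup>+w. norm (s w - t w) \<partial>M)"
    using simple_bochner_integral_norm_le_nn_integral[OF st] simple_bochner_integral_diff[OF s t] by simp
  also have "\<dots> \<le> (\<integral>\<^sup>+w. norm (f w - s w) \<partial>M) + (\<integral>\<^sup>+w. norm (f w - t w) \<partial>M)"
  proof (intro nn_integral_norm_le strongly_measurable_diff f AE_I2
      simple_bochner_integrable_strongly_measurable[OF s] simple_bochner_integrable_strongly_measurable[OF t])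
    fix w
    show "norm (s w - t w) \<le> norm (f w - s w) + norm (f w - t w)"
      using norm_triangle_ineq4[of "f w - t w" "f w - s w"] by simp
  qed
  finally show ?thesis .
qed

lemma tendsto_zero_ennreal_le:
  fixes f g :: "nat \<Rightarrow> ennreal"
  assumes "\<And>i. f i \<le> g i" "g \<longlonglongrightarrow> 0"
  shows "f \<longlonglongrightarrow> 0"
  by (rule tendsto_sandwich[of "\<lambda>_. 0" _ _ g]) (use assms in auto)

lemma has_banach_integralI:
  fixes f :: "'w \<Rightarrow> 'b::real_normed_vector"
  assumes "strongly_measurable M f" "\<And>i. sb_integrable M (s i)"
    "(\<lambda>i. \<integral>\<^sup>+w. norm (f w - s i w) \<partial>M) \<longlonglongrightarrow> 0" "(\<lambda>i. sb_integral M (s i)) \<longlonglongrightarrow> I"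
  shows "has_banach_integral M f I"
  using assms unfolding has_banach_integral_def by blast

lemma has_banach_integralE:
  fixes f :: "'w \<Rightarrow> 'b::real_normed_vector"
  assumes "has_banach_integral M f I"
  obtains s where "strongly_measurable M f" "\<And>i. sb_integrable M (s i)"
    "(\<lambda>i. \<integral>\<^sup>+w. norm (f w - s i w) \<partial>M) \<longlonglongrightarrow> 0" "(\<lambda>i. sb_integral M (s i)) \<longlonglongrightarrow> I"
  using assms unfolding has_banach_integral_def by blast

lemma has_banach_integral_unique:
  assumes "has_banach_integral M f I" "has_banach_integral M f J"
  shows "I = J"
proof -
  obtain s where s: "strongly_measurable M f" "\<And>i. sb_integrable M (s i)"
    "(\<lambda>i. \<integral>\<^sup>+w. norm (f w - s i w) \<partial>M) \<longlonglongrightarrow> 0" "(\<lambda>i. sb_integral M (s i)) \<longlonglongrightarrow> I"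
    using assms(1) by (elim has_banach_integralE) blast
  obtain t where t: "\<And>i. sb_integrable M (t i)"
    "(\<lambda>i. \<integral>\<^sup>+w. norm (f w - t i w) \<partial>M) \<longlonglongrightarrow> 0" "(\<lambda>i. sb_integral M (t i)) \<longlonglongrightarrow> J"
    using assms(2) by (elim has_banach_integralE) blast
  have "(\<lambda>i. (\<integral>\<^sup>+w. norm (f w - s i w) \<partial>M) + (\<integral>\<^sup>+w. norm (f w - t i w) \<partial>M)) \<longlonglongrightarrow> 0"
    using tendsto_add[OF s(3) t(2)] by simp
  then have "(\<lambda>i. ennreal (norm (sb_integral M (s i) - sb_integral M (t i)))) \<longlonglongrightarrow> ennreal 0"
    by (simp add: tendsto_zero_ennreal_le[OF simple_bochner_integral_dist_le[OF s(1,2) t(1)]])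
  then have "(\<lambda>i. norm (sb_integral M (s i) - sb_integral M (t i))) \<longlonglongrightarrow> 0"
    by (subst (asm) tendsto_ennreal_iff) auto
  moreover have "(\<lambda>i. norm (sb_integral M (s i) - sb_integral M (t i))) \<longlonglongrightarrow> norm (I - J)"
    by (intro tendsto_intros s t)
  ultimately have "norm (I - J) = 0" by (rule LIMSEQ_unique[symmetric])
  then show ?thesis by simp
qed

lemma banach_integral_eqI: "has_banach_integral M f I \<Longrightarrow> banach_integral M f = I"
  unfolding banach_integral_def by (rule the_equality) (auto dest: has_banach_integral_unique)

lemma has_banach_integral_banach_integral:
  "banach_integrable M f \<Longrightarrow> has_banach_integral M f (banach_integral M f)"
  unfolding banach_integrable_def using banach_integral_eqI by metis

lemma banach_integrableI: "has_banach_integral M f I \<Longrightarrow> banach_integrable M f"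
  unfolding banach_integrable_def by blast

lemma has_banach_integral_cong_AE:
  assumes f: "has_banach_integral M f I" and eq: "AE w in M. f w = g w"
  shows "has_banach_integral M g I"
proof -
  obtain s where s: "strongly_measurable M f" "\<And>i. sb_integrable M (s i)"
    "(\<lambda>i. \<integral>\<^sup>+w. norm (f w - s i w) \<partial>M) \<longlonglongrightarrow> 0" "(\<lambda>i. sb_integral M (s i)) \<longlonglongrightarrow> I"
    using f by (elim has_banach_integralE) blast
  have "(\<integral>\<^sup>+w. norm (g w - s i w) \<partial>M) = (\<integral>\<^sup>+w. norm (f w - s i w) \<partial>M)" for i
    by (rule nn_integral_cong_AE) (use eq in eventually_elim, simp)
  then show ?thesis
    using s by (intro has_banach_integralI[of _ _ s] strongly_measurable_cong_AE[OF s(1) eq]) simp_all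
qed

lemma has_banach_integral_add:
  assumes f: "has_banach_integral M f I" and g: "has_banach_integral M g J"
  shows "has_banach_integral M (\<lambda>w. f w + g w) (I + J)"
proof -
  obtain s where s: "strongly_measurable M f" "\<And>i. sb_integrable M (s i)"
    "(\<lambda>i. \<integral>\<^sup>+w. norm (f w - s i w) \<partial>M) \<longlonglongrightarrow> 0" "(\<lambda>i. sb_integral M (s i)) \<longlonglongrightarrow> I"
    using f by (elim has_banach_integralE) blast
  obtain t where t: "strongly_measurable M g" "\<And>i. sb_integrable M (t i)"
    "(\<lambda>i. \<integral>\<^sup>+w. norm (g w - t i w) \<partial>M) \<longlonglongrightarrow> 0" "(\<lambda>i. sb_integral M (t i)) \<longlonglongrightarrow> J"
    using g by (elim has_banach_integralE) blast
  show ?thesis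
  proof (rule has_banach_integralI[where s = "\<lambda>i w. s i w + t i w"])
    show "strongly_measurable M (\<lambda>w. f w + g w)" by (intro strongly_measurable_add s t)
    show "sb_integrable M (\<lambda>w. s i w + t i w)" for i
      using simple_bochner_integrable_compose2[of "(+)" M "s i" "t i"] s t by simp
    show "(\<lambda>i. sb_integral M (\<lambda>w. s i w + t i w)) \<longlonglongrightarrow> I + J"
      unfolding simple_bochner_integral_add[OF s(2) t(2)] by (intro tendsto_add s t)
    show "(\<lambda>i. \<integral>\<^sup>+w. norm (f w + g w - (s i w + t i w)) \<partial>M) \<longlonglongrightarrow> 0"
    proof (rule tendsto_zero_ennreal_le)
      show "(\<lambda>i. (\<integral>\<^sup>+w. norm (f w - s i w) \<partial>M) + (\<integral>\<^sup>+w. norm (g w - t i w) \<partial>M)) \<longlonglongrightarrow> 0"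
        using tendsto_add[OF s(3) t(3)] by simp
      show "(\<integral>\<^sup>+w. norm (f w + g w - (s i w + t i w)) \<partial>M)
          \<le> (\<integral>\<^sup>+w. norm (f w - s i w) \<partial>M) + (\<integral>\<^sup>+w. norm (g w - t i w) \<partial>M)" for i
        by (intro nn_integral_norm_le strongly_measurable_diff s t simple_bochner_integrable_strongly_measurable
            AE_I2 norm_diff_triangle_ineq)
    qed
  qed
qed

lemma has_banach_integral_bounded_linear:
  assumes T: "bounded_linear T" and f: "has_banach_integral M f I"
  shows "has_banach_integral M (\<lambda>w. T (f w)) (T I)"
proof -
  interpret T: bounded_linear T by fact
  obtain s where s: "strongly_measurable M f" "\<And>i. sb_integrable M (s i)"
    "(\<lambda>i. \<integral>\<^sup>+w. norm (f w - s i w) \<partial>M) \<longlonglongrightarrow> 0" "(\<lambda>i. sb_integral M (s i)) \<longlonglongrightarrow> I"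
    using f by (elim has_banach_integralE) blast
  obtain K where K: "K > 0" "\<And>x. norm (T x) \<le> norm x * K" using T.pos_bounded by blast
  show ?thesis
  proof (rule has_banach_integralI[where s = "\<lambda>i w. T (s i w)"])
    show "strongly_measurable M (\<lambda>w. T (f w))" by (rule strongly_measurable_compose[OF s(1) T.tendsto])
    show "sb_integrable M (\<lambda>w. T (s i w))" for i
      using simple_bochner_integrable_compose2[of "\<lambda>x y. T x" M "s i" "s i"] s by (simp add: T.zero)
    show "(\<lambda>i. sb_integral M (\<lambda>w. T (s i w))) \<longlonglongrightarrow> T I"
      unfolding simple_bochner_integral_linear[OF T.linear_axioms s(2)] by (intro T.tendsto s)
    show "(\<lambda>i. \<integral>\<^sup>+w. norm (T (f w) - T (s i w)) \<partial>M) \<longlonglongrightarrow> 0"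
    proof (rule tendsto_zero_ennreal_le)
      show "(\<lambda>i. ennreal K * (\<integral>\<^sup>+w. norm (f w - s i w) \<partial>M)) \<longlonglongrightarrow> 0"
        using ennreal_tendsto_cmult[OF _ s(3), of "ennreal K"] by simp
      fix i
      have "(\<integral>\<^sup>+w. norm (T (f w) - T (s i w)) \<partial>M) \<le> (\<integral>\<^sup>+w. K * norm (f w - s i w) \<partial>M)"
        using K(2) by (intro nn_integral_mono ennreal_leI) (simp add: mult.commute flip: T.diff)
      also have "\<dots> = ennreal K * (\<integral>\<^sup>+w. norm (f w - s i w) \<partial>M)"
        using K(1) by (intro nn_integral_norm_scaleR strongly_measurable_diff s simple_bochner_integrable_strongly_measurable) simp
      finally show "(\<integral>\<^sup>+w. norm (T (f w) - T (s i w)) \<partial>M) \<le> ennreal K * (\<integral>\<^sup>+w. norm (f w - s i w) \<partial>M)" .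
    qed
  qed
qed

lemma nn_integral_norm_finite_of_integral:
  assumes "has_banach_integral M f I"
  shows "(\<integral>\<^sup>+w. norm (f w) \<partial>M) < \<infinity>"
proof -
  obtain s where s: "strongly_measurable M f" "\<And>i. sb_integrable M (s i)"
    "(\<lambda>i. \<integral>\<^sup>+w. norm (f w - s i w) \<partial>M) \<longlonglongrightarrow> 0"
    using assms by (elim has_banach_integralE) blast
  have "eventually (\<lambda>i. (\<integral>\<^sup>+w. norm (f w - s i w) \<partial>M) < 1) sequentially"
    by (rule order_tendstoD[OF s(3)]) simp
  then obtain i where i: "(\<integral>\<^sup>+w. norm (f w - s i w) \<partial>M) < 1"
    by (auto dest: eventually_happens)
  have n: "sb_integrable M (\<lambda>w. norm (s i w))"
    using simple_bochner_integrable_compose2[of "\<lambda>x y. norm x" M "s i" "s i"] s(2) by simp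
  have "(\<integral>\<^sup>+w. norm (s i w) \<partial>M) < \<infinity>"
    by (subst simple_bochner_integral_eq_nn_integral[OF n, symmetric]) simp_all
  moreover have "(\<integral>\<^sup>+w. norm (f w) \<partial>M) \<le> (\<integral>\<^sup>+w. norm (s i w) \<partial>M) + (\<integral>\<^sup>+w. norm (f w - s i w) \<partial>M)"
    by (intro nn_integral_norm_le strongly_measurable_diff s simple_bochner_integrable_strongly_measurable
        AE_I2 norm_triangle_sub)
  moreover have "(\<integral>\<^sup>+w. norm (f w - s i w) \<partial>M) < \<infinity>"
    using i by (rule less_trans) simp
  ultimately show ?thesis by (simp add: le_less_trans ennreal_add_less_top)
qed

text \<open>
  Cutting off at \<open>2 * norm x\<close> leaves the limit unchanged: if \<open>x\<close> is nonzero the cut is eventually inactive, and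
  otherwise it only makes the terms smaller.
\<close>

lemma tendsto_truncate:
  fixes X :: "nat \<Rightarrow> 'b::real_normed_vector"
  assumes X: "X \<longlonglongrightarrow> x"
  shows "(\<lambda>i. if norm (X i) \<le> 2 * norm x then X i else 0) \<longlonglongrightarrow> x"
proof (cases "x = 0")
  case True
  then show ?thesis
    using Lim_null_comparison[OF _ tendsto_norm_zero[OF X[unfolded True]],
        of "\<lambda>i. if norm (X i) \<le> 2 * norm x then X i else 0"] by simp
next
  case False
  have "eventually (\<lambda>i. norm (X i) < 2 * norm x) sequentially"
    by (rule order_tendstoD[OF tendsto_norm[OF X]]) (use False in simp)
  then show ?thesis
    by (intro Lim_transform_eventually[OF X]) (auto elim: eventually_mono)
qed

text \<open>
  The approximating simple functions are cut off at \<open>2 * norm (f w)\<close>, so that the errors are dominated by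
  \<open>3 * norm (f w)\<close> and converge to zero in mean; their integrals then form a Cauchy sequence.
\<close>

theorem banach_integrable_bounded:
  fixes f :: "'w \<Rightarrow> 'b::banach"
  assumes f: "strongly_measurable M f" and fin: "(\<integral>\<^sup>+w. norm (f w) \<partial>M) < \<infinity>"
  shows "banach_integrable M f"
proof -
  obtain s where s: "\<And>i. simple_function M (s i)" "AE w in M. (\<lambda>i::nat. s i w) \<longlonglongrightarrow> f w"
    using f unfolding strongly_measurable_def by blast
  obtain h where h: "h \<in> borel_measurable M" "AE w in M. norm (f w) = h w"
    using strongly_measurable_norm_AE[OF f] .
  define t where "t i w = (if norm (s i w) \<le> 2 * h w then s i w else 0)" for i w
  have tsf: "simple_function M (t i)" for i
  proof -
    have "(\<lambda>w. norm (s i w)) \<in> borel_measurable M"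
      by (intro borel_measurable_simple_function simple_function_compose1[OF s(1)])
    then have "{w \<in> space M. norm (s i w) \<le> 2 * h w} \<in> sets M" using h(1) by measurable
    then have "simple_function M (\<lambda>w. if norm (s i w) \<le> 2 * h w then s i w else 0)"
      by (rule simple_function_If[OF s(1) simple_function_const])
    then show ?thesis unfolding t_def[abs_def] .
  qed
  have tlim: "AE w in M. (\<lambda>i. t i w) \<longlonglongrightarrow> f w"
    using s(2) h(2)
  proof eventually_elim
    case (elim w)
    then show ?case using tendsto_truncate[OF elim(1)] by (simp add: t_def)
  qed
  have tbound: "AE w in M. norm (t i w) \<le> 2 * norm (f w)" for i
    using h(2)
  proof eventually_elim
    case (elim w)
    then have "0 \<le> h w" by (metis norm_ge_zero)
    then show ?case by (simp add: t_def elim)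
  qed
  have tint: "sb_integrable M (t i)" for i
  proof (rule simple_bochner_integrableI_bounded[OF tsf])
    have "(\<integral>\<^sup>+w. norm (t i w) \<partial>M) \<le> (\<integral>\<^sup>+w. 2 * norm (f w) \<partial>M)"
      by (intro nn_integral_mono_AE) (use tbound[of i] in eventually_elim, rule ennreal_leI)
    also have "\<dots> = ennreal 2 * (\<integral>\<^sup>+w. norm (f w) \<partial>M)" by (intro nn_integral_norm_scaleR f) simp
    finally show "(\<integral>\<^sup>+w. norm (t i w) \<partial>M) < \<infinity>"
      using fin by (auto simp: ennreal_mult_less_top intro: le_less_trans)
  qed
  have "\<exists>k. k \<in> borel_measurable M \<and> (AE w in M. norm (f w - t i w) = k w)" for i
    using strongly_measurable_norm_AE[OF strongly_measurable_diff[OF f strongly_measurable_simple_function[OF tsf]]]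
    by metis
  then obtain k :: "nat \<Rightarrow> 'w \<Rightarrow> real" where k: "\<And>i. k i \<in> borel_measurable M" "\<And>i. AE w in M. norm (f w - t i w) = k i w"
    by metis
  have "(\<lambda>i. \<integral>\<^sup>+w. ennreal (k i w) \<partial>M) \<longlonglongrightarrow> (\<integral>\<^sup>+w. 0 \<partial>M)"
  proof (rule nn_integral_dominated_convergence)
    show "(\<lambda>w. ennreal (k i w)) \<in> borel_measurable M" for i using k(1) by simp
    show "(\<lambda>w. ennreal (3 * h w)) \<in> borel_measurable M" using h(1) by simp
    have "(\<integral>\<^sup>+w. ennreal (3 * h w) \<partial>M) = (\<integral>\<^sup>+w. 3 * norm (f w) \<partial>M)"
      by (rule nn_integral_cong_AE) (use h(2) in eventually_elim, simp)
    also have "\<dots> = ennreal 3 * (\<integral>\<^sup>+w. norm (f w) \<partial>M)" by (intro nn_integral_norm_scaleR f) simp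
    finally show "(\<integral>\<^sup>+w. ennreal (3 * h w) \<partial>M) < \<infinity>" using fin by (simp add: ennreal_mult_less_top)
    show "AE w in M. ennreal (k i w) \<le> ennreal (3 * h w)" for i
      using tbound[of i] h(2) k(2)[of i]
    proof eventually_elim
      case (elim w)
      then show ?case using norm_triangle_ineq4[of "f w" "t i w"] by (intro ennreal_leI) simp
    qed
    have "AE w in M. \<forall>i. norm (f w - t i w) = k i w" unfolding AE_all_countable using k(2) by blast
    then show "AE w in M. (\<lambda>i. ennreal (k i w)) \<longlonglongrightarrow> 0"
      using tlim
    proof eventually_elim
      case (elim w)
      have "(\<lambda>i. norm (f w - t i w)) \<longlonglongrightarrow> norm (f w - f w)" by (intro tendsto_intros elim)
      then have "(\<lambda>i. ennreal (k i w)) \<longlonglongrightarrow> ennreal 0" using elim(1) by (intro tendsto_ennrealI) simp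
      then show ?case by simp
    qed
  qed simp
  moreover have "(\<integral>\<^sup>+w. ennreal (k i w) \<partial>M) = (\<integral>\<^sup>+w. norm (f w - t i w) \<partial>M)" for i
    by (rule nn_integral_cong_AE) (use k(2)[of i] in eventually_elim, simp)
  ultimately have lim: "(\<lambda>i. \<integral>\<^sup>+w. norm (f w - t i w) \<partial>M) \<longlonglongrightarrow> 0" by simp
  have "Cauchy (\<lambda>i. sb_integral M (t i))"
  proof (rule metric_CauchyI)
    fix e :: real assume e: "0 < e"
    have "eventually (\<lambda>i. (\<integral>\<^sup>+w. norm (f w - t i w) \<partial>M) < ennreal (e / 2)) sequentially"
      by (rule order_tendstoD[OF lim]) (use e in simp)
    then obtain N where N: "\<And>n. n \<ge> N \<Longrightarrow> (\<integral>\<^sup>+w. norm (f w - t n w) \<partial>M) < ennreal (e / 2)"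
      by (auto simp: eventually_sequentially)
    have "dist (sb_integral M (t m)) (sb_integral M (t n)) < e" if "m \<ge> N" "n \<ge> N" for m n
    proof -
      have "ennreal (norm (sb_integral M (t m) - sb_integral M (t n))) < ennreal (e / 2) + ennreal (e / 2)"
        by (rule le_less_trans[OF simple_bochner_integral_dist_le[OF f tint tint]])
          (intro add_strict_mono N that)
      also have "\<dots> = ennreal e" using e by (simp flip: ennreal_plus)
      finally show ?thesis using e by (simp add: dist_norm ennreal_less_iff)
    qed
    then show "\<exists>N. \<forall>m\<ge>N. \<forall>n\<ge>N. dist (sb_integral M (t m)) (sb_integral M (t n)) < e" by blast
  qed
  then obtain I where "(\<lambda>i. sb_integral M (t i)) \<longlonglongrightarrow> I" using convergentD Cauchy_convergent by blast
  then show ?thesis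
    using has_banach_integralI[OF f tint lim] by (auto simp: banach_integrable_def)
qed

lemma banach_integrable_iff:
  fixes f :: "'w \<Rightarrow> 'b::banach"
  shows "banach_integrable M f \<longleftrightarrow> strongly_measurable M f \<and> (\<integral>\<^sup>+w. norm (f w) \<partial>M) < \<infinity>"
  using banach_integrable_bounded nn_integral_norm_finite_of_integral
  unfolding banach_integrable_def has_banach_integral_def by blast

section \<open>Integrals of positive functions\<close>

text \<open>
  Simple approximants of a positive function need not be positive or self-adjoint, so positivity cannot be
  checked on them. Instead the norm criterion for positivity is integrated: pointwise
  \<open>norm (norm (f w) - f w) \<le> norm (f w)\<close>, and the same inequality holds up to a small error for an approximant \<open>s i\<close>
  and hence between its integral and \<open>\<rho>\<close>, the integral of \<open>norm (s i w)\<close>. Adding the multiple \<open>4 * e\<close> of the unit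
  absorbs the error: \<open>3 * e\<close> for the approximation under the integral and \<open>e\<close> for the distance of the integrals.
\<close>

theorem has_banach_integral_positive:
  fixes f :: "'w \<Rightarrow> 'a::cstar_algebra"
  assumes f: "has_banach_integral M f I" and pos: "\<And>w. cstar_positive (f w)"
  shows "cstar_positive I"
proof -
  obtain s where s: "strongly_measurable M f" "\<And>i. sb_integrable M (s i)"
    "(\<lambda>i. \<integral>\<^sup>+w. norm (f w - s i w) \<partial>M) \<longlonglongrightarrow> 0" "(\<lambda>i. sb_integral M (s i)) \<longlonglongrightarrow> I"
    using f by (elim has_banach_integralE) blast
  have "has_banach_integral M f (star I)"
    using has_banach_integral_bounded_linear[OF bounded_linear_star f] by (simp add: cstar_positive_star[OF pos])
  then have sI: "star I = I" using has_banach_integral_unique f by blast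
  have near: "cstar_positive (I + (4 * e) *\<^sub>R 1)" if e: "e > 0" for e :: real
  proof -
    have "eventually (\<lambda>i. (\<integral>\<^sup>+w. norm (f w - s i w) \<partial>M) < ennreal e) sequentially"
      by (rule order_tendstoD[OF s(3)]) (use e in simp)
    moreover have "eventually (\<lambda>i. norm (sb_integral M (s i) - I) < e) sequentially"
      using tendstoD[OF s(4) e] by (simp add: dist_norm)
    ultimately have "eventually (\<lambda>i. (\<integral>\<^sup>+w. norm (f w - s i w) \<partial>M) < ennreal e
        \<and> norm (sb_integral M (s i) - I) < e) sequentially" by (rule eventually_conj)
    then obtain i where i: "(\<integral>\<^sup>+w. norm (f w - s i w) \<partial>M) < ennreal e" "norm (sb_integral M (s i) - I) < e"
      by (auto dest: eventually_happens)
    have ns: "sb_integrable M (\<lambda>w. norm (s i w))"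
      using simple_bochner_integrable_compose2[of "\<lambda>x y. norm x" M "s i" "s i"] s(2) by simp
    have n1: "sb_integrable M (\<lambda>w. norm (s i w) *\<^sub>R (1::'a))"
      using simple_bochner_integrable_compose2[of "\<lambda>x y. norm x *\<^sub>R (1::'a)" M "s i" "s i"] s(2) by simp
    have nd: "sb_integrable M (\<lambda>w. norm (s i w) *\<^sub>R 1 - s i w)"
      using simple_bochner_integrable_compose2[of "\<lambda>x y. norm x *\<^sub>R 1 - x" M "s i" "s i"] s(2) by simp
    define \<rho> where "\<rho> = sb_integral M (\<lambda>w. norm (s i w))"
    have "linear (\<lambda>r::real. r *\<^sub>R (1::'a))" by (simp add: linear_scale_left)
    then have "sb_integral M (\<lambda>w. norm (s i w) *\<^sub>R (1::'a)) = \<rho> *\<^sub>R 1"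
      unfolding \<rho>_def by (rule simple_bochner_integral_linear[OF _ ns])
    then have "ennreal (norm (\<rho> *\<^sub>R 1 - sb_integral M (s i))) \<le> (\<integral>\<^sup>+w. norm (norm (s i w) *\<^sub>R 1 - s i w) \<partial>M)"
      using simple_bochner_integral_norm_le_nn_integral[OF nd] simple_bochner_integral_diff[OF n1 s(2)] by simp
    also have "\<dots> \<le> (\<integral>\<^sup>+w. norm (s i w) \<partial>M) + (\<integral>\<^sup>+w. norm (3 *\<^sub>R (f w - s i w)) \<partial>M)"
    proof (rule nn_integral_norm_le)
      show "strongly_measurable M (s i)" by (rule simple_bochner_integrable_strongly_measurable[OF s(2)])
      then have "strongly_measurable M (\<lambda>w. f w - s i w)" by (rule strongly_measurable_diff[OF s(1)])
      then show "strongly_measurable M (\<lambda>w. 3 *\<^sub>R (f w - s i w))"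
        by (rule strongly_measurable_compose) (intro tendsto_intros)
      have "norm (norm (s i w) *\<^sub>R 1 - s i w) \<le> norm (s i w) + norm (3 *\<^sub>R (f w - s i w))" for w
      proof -
        have p: "norm (norm (f w) *\<^sub>R 1 - f w) \<le> norm (f w)"
          by (rule cstar_positive_norm_diff[OF pos order_refl])
        have "norm (s i w) *\<^sub>R 1 - s i w
            = (norm (f w) *\<^sub>R 1 - f w) + ((norm (s i w) - norm (f w)) *\<^sub>R 1 + (f w - s i w))"
          by (simp add: algebra_simps)
        also have "norm \<dots> \<le> norm (f w) + (\<bar>norm (s i w) - norm (f w)\<bar> + norm (f w - s i w))"
          by (intro norm_triangle_le add_mono p norm_triangle_ineq[THEN order_trans]) simp_all
        also have "\<dots> \<le> norm (s i w) + 3 * norm (f w - s i w)"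
          using norm_triangle_ineq3[of "s i w" "f w"] norm_triangle_sub[of "f w" "s i w"]
          by (simp add: norm_minus_commute)
        finally show ?thesis by simp
      qed
      then show "AE w in M. norm (norm (s i w) *\<^sub>R 1 - s i w) \<le> norm (s i w) + norm (3 *\<^sub>R (f w - s i w))" by simp
    qed
    also have "(\<integral>\<^sup>+w. norm (s i w) \<partial>M) = ennreal \<rho>"
      unfolding \<rho>_def by (rule simple_bochner_integral_eq_nn_integral[OF ns, symmetric]) simp
    also have "(\<integral>\<^sup>+w. norm (3 *\<^sub>R (f w - s i w)) \<partial>M) = ennreal 3 * (\<integral>\<^sup>+w. norm (f w - s i w) \<partial>M)"
      using nn_integral_norm_scaleR[of M "\<lambda>w. f w - s i w" 3]
        strongly_measurable_diff[OF s(1) simple_bochner_integrable_strongly_measurable[OF s(2)]] by simp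
    also have "ennreal \<rho> + ennreal 3 * (\<integral>\<^sup>+w. norm (f w - s i w) \<partial>M) \<le> ennreal \<rho> + ennreal 3 * ennreal e"
      using i(1) by (intro add_left_mono mult_left_mono) auto
    also have "\<dots> = ennreal (\<rho> + 3 * e)"
      using e by (simp add: \<rho>_def ennreal_plus ennreal_mult)
    finally have "norm (\<rho> *\<^sub>R 1 - sb_integral M (s i)) \<le> \<rho> + 3 * e"
      using e by (subst (asm) ennreal_le_iff) (simp_all add: \<rho>_def)
    then have "norm ((\<rho> *\<^sub>R 1 - sb_integral M (s i)) + (sb_integral M (s i) - I)) \<le> (\<rho> + 3 * e) + e"
      using i(2) by (intro norm_triangle_le add_mono) auto
    then have "norm ((\<rho> + 4 * e) *\<^sub>R 1 - (I + (4 * e) *\<^sub>R 1)) \<le> \<rho> + 4 * e"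
      by (simp add: scaleR_add_left)
    then show ?thesis by (intro cstar_positiveI_norm) (simp_all add: star_add star_scaleR sI)
  qed
  show ?thesis
  proof (rule cstar_positive_limit)
    show "cstar_positive (I + (4 * (1 / real (Suc n))) *\<^sub>R 1)" for n by (rule near) simp
    have "(\<lambda>n. I + (4 * (1 / real (Suc n))) *\<^sub>R 1) \<longlonglongrightarrow> I + (4 * 0) *\<^sub>R 1"
      by (intro tendsto_intros LIMSEQ_inverse_real_of_nat[unfolded inverse_eq_divide])
    then show "(\<lambda>n. I + (4 * (1 / real (Suc n))) *\<^sub>R 1) \<longlonglongrightarrow> I" by simp
  qed
qed

section \<open>Square-integrable families in a Hilbert module\<close>

text \<open>
  The inner square of the family \<open>f\<close> in the space of square-integrable families.
\<close>

definition gram ::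
    "'w measure \<Rightarrow> ('h::banach \<Rightarrow> 'h \<Rightarrow> 'a::cstar_algebra) \<Rightarrow> ('w \<Rightarrow> 'h) \<Rightarrow> 'a" where
  "gram M ip f = banach_integral M (\<lambda>w. ip (f w) (f w))"

text \<open>
  The upper half of a frame inequality with norms in place of the order of the algebra. In this form it can
  be added up over several families.
\<close>

definition bessel_family ::
    "'w measure \<Rightarrow> ('h::banach \<Rightarrow> 'h \<Rightarrow> 'a::cstar_algebra) \<Rightarrow> ('w \<Rightarrow> 'h \<Rightarrow> 'h) \<Rightarrow> bool" where
  "bessel_family M ip F \<longleftrightarrow>
     (\<exists>C. \<forall>x. (\<lambda>w. F w x) \<in> l2_families M ip \<and> norm (gram M ip (\<lambda>w. F w x)) \<le> C * (norm x)\<^sup>2)"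

lemma gram_has_integral:
  "f \<in> l2_families M ip \<Longrightarrow> has_banach_integral M (\<lambda>w. ip (f w) (f w)) (gram M ip f)"
  unfolding gram_def l2_families_def by (simp add: has_banach_integral_banach_integral)

lemma gram_cong_AE:
  assumes "f \<in> l2_families M ip" "AE w in M. f w = g w"
  shows "gram M ip g = gram M ip f"
  unfolding gram_def[of M ip g]
  by (rule banach_integral_eqI[OF has_banach_integral_cong_AE[OF gram_has_integral[OF assms(1)]]])
    (use assms(2) in eventually_elim, simp)

context hilbert_cstar_module
begin

lemma ip_add_right: "ip x (y + z) = ip x y + ip x z"
  by (metis ip_add_left ip_commute star_add)

lemma ip_scaleR_left: "ip (r *\<^sub>R x) y = r *\<^sub>R ip x y"
  by (simp add: scaleR_eq_act ip_act_left)

lemma ip_scaleR_right: "ip x (r *\<^sub>R y) = r *\<^sub>R ip x y"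
  by (metis ip_scaleR_left ip_commute star_scaleR)

lemma ip_minus_left: "ip (- x) y = - ip x y"
  using ip_scaleR_left[of "-1" x y] by simp

lemma ip_minus_right: "ip x (- y) = - ip x y"
  using ip_scaleR_right[of x "-1" y] by simp

lemma ip_diff_left: "ip (x - y) z = ip x z - ip y z"
  using ip_add_left[of x "- y" z] by (simp add: ip_minus_left)

lemma ip_diff_right: "ip x (y - z) = ip x y - ip x z"
  using ip_add_right[of x y "- z"] by (simp add: ip_minus_right)

lemma ip_act_right: "ip x (act a y) = ip x y * star a"
  by (metis ip_act_left ip_commute star_mult)

lemma norm_ip_self: "norm (ip x x) = (norm x)\<^sup>2"
  by (simp add: norm_eq_sqrt_ip[of x])

lemma ip_eqI:
  assumes "\<And>y. ip u y = ip v y"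
  shows "u = v"
  using ip_definite[of "u - v"] assms by (simp add: ip_diff_left)

text \<open>
  A crude form of the Cauchy-Schwarz inequality, obtained for unit vectors by expanding the inner square of
  \<open>u + v\<close> into \<open>4 + 1 + 1\<close>. It serves the continuity of inner squares.
\<close>

lemma norm_ip_symmetrised_le: "norm (ip x y + ip y x) \<le> 6 * norm x * norm y"
proof (cases "x = 0 \<or> y = 0")
  case True
  then show ?thesis
    using ip_scaleR_left[of 0 x y] ip_scaleR_left[of 0 y x] ip_scaleR_right[of x 0 y] ip_scaleR_right[of y 0 x] by auto
next
  case False
  define u v where "u = (1 / norm x) *\<^sub>R x" and "v = (1 / norm y) *\<^sub>R y"
  have n: "norm u = 1" "norm v = 1" using False by (simp_all add: u_def v_def)
  have "ip u v + ip v u = ip (u + v) (u + v) - ip u u - ip v v"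
    by (simp add: ip_add_left ip_add_right)
  also have "norm \<dots> \<le> norm (ip (u + v) (u + v)) + norm (ip u u) + norm (ip v v)"
    by (intro norm_triangle_le_diff add_mono norm_triangle_ineq4 order_refl)
  also have "\<dots> \<le> 2\<^sup>2 + 1 + 1"
    using power_mono[OF norm_triangle_ineq[of u v], of 2] n by (simp add: norm_ip_self)
  finally have *: "norm (ip u v + ip v u) \<le> 6" by simp
  have "x = norm x *\<^sub>R u" "y = norm y *\<^sub>R v" using False by (simp_all add: u_def v_def)
  then have "ip x y + ip y x = (norm x * norm y) *\<^sub>R (ip u v + ip v u)"
    by (metis (no_types) ip_scaleR_left ip_scaleR_right scaleR_add_right scaleR_scaleR mult.commute)
  then have "norm (ip x y + ip y x) = (norm x * norm y) * norm (ip u v + ip v u)" by simp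
  also have "\<dots> \<le> (norm x * norm y) * 6" by (intro mult_left_mono *) simp
  finally show ?thesis by simp
qed

lemma tendsto_ip_self:
  assumes X: "X \<longlonglongrightarrow> x"
  shows "(\<lambda>i::nat. ip (X i) (X i)) \<longlonglongrightarrow> ip x x"
proof (rule Lim_transform[OF tendsto_const])
  have d: "(\<lambda>i. norm (X i - x)) \<longlonglongrightarrow> 0" using X by (simp add: LIM_zero tendsto_norm_zero)
  have "(\<lambda>i. (norm (X i - x))\<^sup>2 + 6 * norm (X i - x) * norm x) \<longlonglongrightarrow> 0\<^sup>2 + 6 * 0 * norm x"
    by (intro tendsto_intros d)
  then have b: "(\<lambda>i. (norm (X i - x))\<^sup>2 + 6 * norm (X i - x) * norm x) \<longlonglongrightarrow> 0" by simp
  show "(\<lambda>i. ip (X i) (X i) - ip x x) \<longlonglongrightarrow> 0"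
  proof (rule Lim_null_comparison[OF always_eventually b], rule allI)
    fix i
    let ?d = "X i - x"
    have "ip (X i) (X i) - ip x x = ip ?d ?d + (ip ?d x + ip x ?d)"
      by (simp add: ip_diff_left ip_diff_right)
    also have "norm \<dots> \<le> (norm ?d)\<^sup>2 + 6 * norm ?d * norm x"
      by (rule order_trans[OF norm_triangle_ineq])
        (use norm_ip_symmetrised_le[of ?d x] in \<open>simp add: norm_ip_self\<close>)
    finally show "norm (ip (X i) (X i) - ip x x) \<le> (norm ?d)\<^sup>2 + 6 * norm ?d * norm x" .
  qed
qed

lemma strongly_measurable_ip_self:
  "strongly_measurable M f \<Longrightarrow> strongly_measurable M (\<lambda>w. ip (f w) (f w))"
  by (erule strongly_measurable_compose) (rule tendsto_ip_self)

lemma ip_parallelogram: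
  "2 *\<^sub>R ip x x + 2 *\<^sub>R ip y y - ip (x + y) (x + y) = ip (x - y) (x - y)"
  by (simp add: ip_add_left ip_add_right ip_diff_left ip_diff_right scaleR_2)

text \<open>
  By the parallelogram law the inner square of \<open>x + y\<close> lies below twice the sum of the two inner squares in the
  order of the algebra, and norms are monotone on positive elements.
\<close>

lemma norm_ip_add_le: "norm (ip (x + y) (x + y)) \<le> norm (2 *\<^sub>R ip x x) + norm (2 *\<^sub>R ip y y)"
proof -
  have "norm (ip (x + y) (x + y)) \<le> norm (2 *\<^sub>R ip x x + 2 *\<^sub>R ip y y)"
    by (rule cstar_positive_norm_mono) (simp_all only: ip_positive ip_parallelogram)
  then show ?thesis using norm_triangle_ineq order_trans by blast
qed

lemma gram_positive: "f \<in> l2_families M ip \<Longrightarrow> cstar_positive (gram M ip f)"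
  by (rule has_banach_integral_positive[where f = "\<lambda>w. ip (f w) (f w)" and M = M])
    (simp_all add: gram_has_integral ip_positive)

lemma l2_families_add:
  assumes f: "f \<in> l2_families M ip" and g: "g \<in> l2_families M ip"
  shows "(\<lambda>w. f w + g w) \<in> l2_families M ip"
proof -
  have fg: "strongly_measurable M f" "strongly_measurable M g" using f g by (auto simp: l2_families_def)
  have "has_banach_integral M (\<lambda>w. 2 *\<^sub>R ip (h w) (h w)) (2 *\<^sub>R gram M ip h)" if "h \<in> l2_families M ip" for h
    by (rule has_banach_integral_bounded_linear[OF bounded_linear_scaleR_right gram_has_integral[OF that]])
  then have i: "banach_integrable M (\<lambda>w. 2 *\<^sub>R ip (h w) (h w))" if "h \<in> l2_families M ip" for h
    using that by (blast intro: banach_integrableI)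
  have "(\<integral>\<^sup>+w. norm (ip (f w + g w) (f w + g w)) \<partial>M)
      \<le> (\<integral>\<^sup>+w. norm (2 *\<^sub>R ip (f w) (f w)) \<partial>M) + (\<integral>\<^sup>+w. norm (2 *\<^sub>R ip (g w) (g w)) \<partial>M)"
    using i[OF f] i[OF g] unfolding banach_integrable_iff by (intro nn_integral_norm_le AE_I2 norm_ip_add_le) auto
  also have "\<dots> < \<infinity>"
    using i[OF f] i[OF g] unfolding banach_integrable_iff by (simp add: ennreal_add_less_top)
  finally show ?thesis
    using fg by (simp add: l2_families_def banach_integrable_iff strongly_measurable_add strongly_measurable_ip_self)
qed

text \<open>
  The integrated parallelogram law: what is left over is the integral of the positive function
  \<open>ip (f w - g w) (f w - g w)\<close>.
\<close>

lemma norm_gram_add_le: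
  assumes f: "f \<in> l2_families M ip" and g: "g \<in> l2_families M ip"
  shows "norm (gram M ip (\<lambda>w. f w + g w)) \<le> 2 * norm (gram M ip f) + 2 * norm (gram M ip g)"
proof -
  let ?h = "\<lambda>w. f w + g w"
  have h: "?h \<in> l2_families M ip" by (rule l2_families_add[OF f g])
  have "has_banach_integral M
      (\<lambda>w. (2 *\<^sub>R ip (f w) (f w) + 2 *\<^sub>R ip (g w) (g w)) + - ip (?h w) (?h w))
      ((2 *\<^sub>R gram M ip f + 2 *\<^sub>R gram M ip g) + - gram M ip ?h)"
    by (intro has_banach_integral_add
        has_banach_integral_bounded_linear[OF bounded_linear_scaleR_right]
        has_banach_integral_bounded_linear[OF bounded_linear_minus[OF bounded_linear_ident]]
        gram_has_integral f g h)
  then have "cstar_positive ((2 *\<^sub>R gram M ip f + 2 *\<^sub>R gram M ip g) + - gram M ip ?h)"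
    by (rule has_banach_integral_positive)
      (simp only: ip_parallelogram ip_positive flip: diff_conv_add_uminus)
  then have "norm (gram M ip ?h) \<le> norm (2 *\<^sub>R gram M ip f + 2 *\<^sub>R gram M ip g)"
    by (intro cstar_positive_norm_mono gram_positive h) simp
  also have "\<dots> \<le> 2 * norm (gram M ip f) + 2 * norm (gram M ip g)"
    by (rule norm_triangle_le) simp
  finally show ?thesis .
qed

text \<open>
  This transformation rule is what makes \<open>cstar_le_of_norm_le\<close> applicable: conjugating the Gram element by \<open>a\<close>
  amounts to moving the vectors by \<open>a\<close>.
\<close>

lemma gram_act:
  assumes "f \<in> l2_families M ip"
  shows "gram M ip (\<lambda>w. act a (f w)) = a * gram M ip f * star a"
proof -
  have "has_banach_integral M (\<lambda>w. a * ip (f w) (f w) * star a) (a * gram M ip f * star a)"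
    by (rule has_banach_integral_bounded_linear[OF
          bounded_linear_compose[OF bounded_linear_mult_left bounded_linear_mult_right] gram_has_integral[OF assms]])
  then show ?thesis
    unfolding gram_def[of M ip "\<lambda>w. act a (f w)"]
    by (intro banach_integral_eqI) (simp add: ip_act_left ip_act_right mult.assoc)
qed

lemma bessel_family_add:
  assumes "bessel_family M ip F" "bessel_family M ip G"
  shows "bessel_family M ip (\<lambda>w x. F w x + G w x)"
proof -
  obtain C where C: "\<And>x. (\<lambda>w. F w x) \<in> l2_families M ip" "\<And>x. norm (gram M ip (\<lambda>w. F w x)) \<le> C * (norm x)\<^sup>2"
    using assms(1) unfolding bessel_family_def by blast
  obtain D where D: "\<And>x. (\<lambda>w. G w x) \<in> l2_families M ip" "\<And>x. norm (gram M ip (\<lambda>w. G w x)) \<le> D * (norm x)\<^sup>2"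
    using assms(2) unfolding bessel_family_def by blast
  have "norm (gram M ip (\<lambda>w. F w x + G w x)) \<le> (2 * C + 2 * D) * (norm x)\<^sup>2" for x
    using norm_gram_add_le[OF C(1) D(1), of x x] C(2)[of x] D(2)[of x] by (simp add: algebra_simps)
  then show ?thesis
    unfolding bessel_family_def using l2_families_add[OF C(1) D(1)] by blast
qed

lemma bessel_family_minus:
  assumes "bessel_family M ip F"
  shows "bessel_family M ip (\<lambda>w x. - F w x)"
proof -
  have "(\<lambda>w. - F w x) \<in> l2_families M ip" if "(\<lambda>w. F w x) \<in> l2_families M ip" for x
    using that strongly_measurable_compose[of M "\<lambda>w. F w x" uminus]
    by (simp add: l2_families_def ip_minus_left ip_minus_right tendsto_minus)
  moreover have "gram M ip (\<lambda>w. - F w x) = gram M ip (\<lambda>w. F w x)" for x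
    by (simp add: gram_def ip_minus_left ip_minus_right)
  ultimately show ?thesis using assms unfolding bessel_family_def by metis
qed

lemma bessel_family_sum:
  assumes "finite K" "K \<noteq> {}" "\<And>k. k \<in> K \<Longrightarrow> bessel_family M ip (F k)"
  shows "bessel_family M ip (\<lambda>w x. \<Sum>k\<in>K. F k w x)"
  using assms by (induction K rule: finite_ne_induct) (simp_all add: bessel_family_add)

lemma adjointable_act:
  assumes "F \<in> adjointable ip"
  shows "F (act a x) = act a (F x)"
proof -
  obtain G where G: "\<And>x y. ip (F x) y = ip x (G y)" using assms by (auto simp: adjointable_def)
  show ?thesis by (rule ip_eqI) (simp add: G ip_act_left)
qed

lemma adjointable_sum:
  assumes "finite K" "K \<noteq> {}" "\<And>k. k \<in> K \<Longrightarrow> F k \<in> adjointable ip"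
  shows "(\<lambda>x. \<Sum>k\<in>K. F k x) \<in> adjointable ip"
  using assms
proof (induction K rule: finite_ne_induct)
  case (insert k K)
  then have "F k \<in> adjointable ip" "(\<lambda>x. \<Sum>k\<in>K. F k x) \<in> adjointable ip" by simp_all
  then obtain G H where "\<forall>x y. ip (F k x) y = ip x (G y)" "\<forall>x y. ip (\<Sum>k\<in>K. F k x) y = ip x (H y)"
    unfolding adjointable_def by blast
  then show ?case using insert.hyps
    by (auto simp: adjointable_def ip_add_left ip_add_right intro!: exI[of _ "\<lambda>y. G y + H y"])
qed simp

text \<open>
  Module-linearity turns both the Gram element and \<open>ip x x\<close> at \<open>act b x\<close> into their conjugates by \<open>b\<close>, so norm
  inequalities for all vectors include the conjugated ones required by \<open>cstar_le_of_norm_le\<close>. The theorem is applied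
  twice, with the roles of the two positive elements exchanged.
\<close>

theorem frame_of_norm_bounds:
  assumes adj: "\<And>w. w \<in> space M \<Longrightarrow> F w \<in> adjointable ip"
    and upper: "bessel_family M ip F"
    and lower: "c > 0" "\<And>x. c * (norm x)\<^sup>2 \<le> norm (gram M ip (\<lambda>w. F w x))"
  shows "continuous_operator_frame M ip F"
proof -
  obtain C where C: "\<And>x. (\<lambda>w. F w x) \<in> l2_families M ip" "\<And>x. norm (gram M ip (\<lambda>w. F w x)) \<le> C * (norm x)\<^sup>2"
    using upper unfolding bessel_family_def by blast
  \<comment> \<open>A frame bound has to be strictly positive even when \<open>C\<close> is not, for example on the zero module.\<close>
  define D where "D = max C 1"
  have D: "norm (gram M ip (\<lambda>w. F w x)) \<le> D * (norm x)\<^sup>2" for x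
    using mult_right_mono[of C D "(norm x)\<^sup>2"] C(2)[of x] by (simp add: D_def)
  let ?S = "\<lambda>x. gram M ip (\<lambda>w. F w x)"
  have gram: "b * ?S x * b = ?S (act b x)" if b: "star b = b" for b x
  proof -
    have "?S (act b x) = gram M ip (\<lambda>w. act b (F w x))"
      using adj by (intro gram_cong_AE[symmetric] C) (auto simp: adjointable_act)
    then show ?thesis by (simp add: gram_act[OF C(1)] b)
  qed
  have inner: "b * ip x x * b = ip (act b x) (act b x)" if "star b = b" for b x
    by (simp add: ip_act_left ip_act_right that mult.assoc)
  have up: "?S x \<preceq> D *\<^sub>R ip x x" for x
  proof (rule cstar_le_of_norm_le[OF gram_positive[OF C(1)] ip_positive])
    fix b :: 'a assume b: "star b = b"
    show "norm (b * ?S x * b) \<le> D * norm (b * ip x x * b)"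
      unfolding gram[OF b] inner[OF b] norm_ip_self by (rule D)
  qed (simp add: D_def)
  have "ip x x \<preceq> (1 / c) *\<^sub>R ?S x" for x
  proof (rule cstar_le_of_norm_le[OF ip_positive gram_positive[OF C(1)]])
    fix b :: 'a assume b: "star b = b"
    show "norm (b * ip x x * b) \<le> (1 / c) * norm (b * ?S x * b)"
      unfolding gram[OF b] inner[OF b] norm_ip_self using lower by (simp add: field_simps)
  qed (use lower in simp)
  then have "cstar_positive (c *\<^sub>R ((1 / c) *\<^sub>R ?S x - ip x x))" for x
    using lower(1) by (intro cstar_positive_scaleR) (auto simp: cstar_le_def)
  then have low: "c *\<^sub>R ip x x \<preceq> ?S x" for x
    using lower(1) by (simp add: cstar_le_def scaleR_diff_right)
  have "operator_frame_bounds M ip F c D"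
    unfolding operator_frame_bounds_def
    using lower(1) adj up[unfolded gram_def] low[unfolded gram_def] C(1)
    by (auto simp: D_def l2_families_def)
  then show ?thesis unfolding continuous_operator_frame_def by blast
qed

lemma operator_frame_bessel_family:
  assumes "operator_frame_bounds M ip F a b"
  shows "bessel_family M ip F"
proof -
  have F: "(\<lambda>w. F w x) \<in> l2_families M ip" for x
    using assms by (simp add: operator_frame_bounds_def l2_families_def)
  have "norm (gram M ip (\<lambda>w. F w x)) \<le> b * (norm x)\<^sup>2" for x
  proof -
    have "norm (gram M ip (\<lambda>w. F w x)) \<le> norm (b *\<^sub>R ip x x)"
      using assms by (intro cstar_positive_norm_mono gram_positive F)
        (simp add: operator_frame_bounds_def cstar_le_def gram_def)
    then show ?thesis using assms by (simp add: norm_ip_self operator_frame_bounds_def)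
  qed
  with F show ?thesis unfolding bessel_family_def by blast
qed

lemma operator_frame_norm_lower:
  assumes "operator_frame_bounds M ip F a b"
  shows "a * (norm x)\<^sup>2 \<le> norm (gram M ip (\<lambda>w. F w x))"
proof -
  have "norm (a *\<^sub>R ip x x) \<le> norm (gram M ip (\<lambda>w. F w x))"
    using assms by (intro cstar_positive_norm_mono cstar_positive_scaleR ip_positive)
      (simp_all add: operator_frame_bounds_def cstar_le_def gram_def)
  then show ?thesis using assms by (simp add: norm_ip_self operator_frame_bounds_def)
qed

end

theorem theorem3p4:
  fixes M :: "'w measure"
    and act :: "'a::cstar_algebra \<Rightarrow> 'h::banach \<Rightarrow> 'h"
    and ip :: "'h \<Rightarrow> 'h \<Rightarrow> 'a"
    and n p :: nat
    and T R :: "nat \<Rightarrow> 'w \<Rightarrow> 'h \<Rightarrow> 'h"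
    and A B :: "nat \<Rightarrow> real"
    and L :: "('w \<Rightarrow> 'h) \<Rightarrow> ('w \<Rightarrow> 'h)"
    and lam :: real
  assumes "hilbert_cstar_module act ip"
    and "\<And>k. k \<in> {1..n} \<Longrightarrow> operator_frame_bounds M ip (T k) (A k) (B k)"
    and "\<And>k w. k \<in> {1..n} \<Longrightarrow> w \<in> space M \<Longrightarrow> R k w \<in> adjointable ip"
    and "\<And>k x. k \<in> {1..n} \<Longrightarrow> strongly_measurable M (\<lambda>w. R k w x)"
    and "l2_bounded_linear M act ip L"
    and "p \<in> {1..n}"
    and "\<And>x. AE w in M. L (\<lambda>w. \<Sum>k=1..n. R k w x) w = T p w x"
    and "lam > 0"
    and "\<And>k x. k \<in> {1..n} \<Longrightarrow>
           banach_integrable M (\<lambda>w. ip (T k w x - R k w x) (T k w x - R k w x)) \<and>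
           norm (banach_integral M (\<lambda>w. ip (T k w x - R k w x) (T k w x - R k w x)))
             \<le> lam * norm (banach_integral M (\<lambda>w. ip (T k w x) (T k w x)))"
  shows "continuous_operator_frame M ip (\<lambda>w x. \<Sum>k=1..n. R k w x)"
proof -
  interpret hilbert_cstar_module act ip by fact
  let ?F = "\<lambda>w x. \<Sum>k=1..n. R k w x"
  let ?S = "\<lambda>x. gram M ip (\<lambda>w. ?F w x)"
  have T: "bessel_family M ip (T k)" if "k \<in> {1..n}" for k
    by (rule operator_frame_bessel_family[OF assms(2)[OF that]])
  have T_R: "bessel_family M ip (\<lambda>w x. T k w x - R k w x)" if k: "k \<in> {1..n}" for k
  proof -
    obtain C where C: "\<And>x. (\<lambda>w. T k w x) \<in> l2_families M ip"
        "\<And>x. norm (gram M ip (\<lambda>w. T k w x)) \<le> C * (norm x)\<^sup>2"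
      using T[OF k] unfolding bessel_family_def by blast
    have "(\<lambda>w. T k w x - R k w x) \<in> l2_families M ip" for x
      using C(1)[of x] assms(4,9)[OF k, of x] by (simp add: l2_families_def strongly_measurable_diff)
    moreover have "norm (gram M ip (\<lambda>w. T k w x - R k w x)) \<le> (lam * C) * (norm x)\<^sup>2" for x
    proof -
      have "norm (gram M ip (\<lambda>w. T k w x - R k w x)) \<le> lam * norm (gram M ip (\<lambda>w. T k w x))"
        using assms(9)[OF k] by (simp add: gram_def)
      also have "\<dots> \<le> lam * (C * (norm x)\<^sup>2)" using assms(8) by (intro mult_left_mono C) simp
      finally show ?thesis by (simp add: mult.assoc)
    qed
    ultimately show ?thesis unfolding bessel_family_def by blast
  qed
  \<comment> \<open>Here \<open>R k = T k - (T k - R k)\<close>, a difference of two families that are already controlled.\<close>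
  have R: "bessel_family M ip (R k)" if "k \<in> {1..n}" for k
    using bessel_family_add[OF T[OF that] bessel_family_minus[OF T_R[OF that]]] by simp
  have F: "bessel_family M ip ?F"
    using assms(6) R by (intro bessel_family_sum) auto
  then have Fl2: "(\<lambda>w. ?F w x) \<in> l2_families M ip" for x
    unfolding bessel_family_def by blast
  have adj: "?F w \<in> adjointable ip" if "w \<in> space M" for w
    using adjointable_sum[of "{1..n}" "\<lambda>k. R k w"] assms(3,6) that by auto
  obtain K where K: "\<And>f. f \<in> l2_families M ip \<Longrightarrow> l2_norm M ip (L f) \<le> K * l2_norm M ip f"
      and Ll2: "\<And>f. f \<in> l2_families M ip \<Longrightarrow> L f \<in> l2_families M ip"
    using assms(5) unfolding l2_bounded_linear_def by blast
  \<comment> \<open>The bound of \<open>L\<close> may be given as zero or negative, but it is divided by below.\<close>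
  define K' where "K' = max K 1"
  have Ap: "A p > 0" using assms(2)[OF assms(6)] by (simp add: operator_frame_bounds_def)
  have "A p / K'\<^sup>2 * (norm x)\<^sup>2 \<le> norm (?S x)" for x
  proof -
    let ?f = "\<lambda>w. ?F w x"
    have LT: "gram M ip (\<lambda>w. T p w x) = gram M ip (L ?f)"
      by (rule gram_cong_AE[OF Ll2[OF Fl2] assms(7)])
    have "sqrt (norm (gram M ip (L ?f))) \<le> K * sqrt (norm (?S x))"
      using K[OF Fl2] by (simp add: l2_norm_def gram_def)
    also have "\<dots> \<le> K' * sqrt (norm (?S x))" by (intro mult_right_mono) (simp_all add: K'_def)
    finally have "(sqrt (norm (gram M ip (L ?f))))\<^sup>2 \<le> (K' * sqrt (norm (?S x)))\<^sup>2"
      by (intro power_mono) simp_all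
    then have "norm (gram M ip (L ?f)) \<le> K'\<^sup>2 * norm (?S x)" by (simp add: power_mult_distrib)
    then have "A p * (norm x)\<^sup>2 \<le> K'\<^sup>2 * norm (?S x)"
      using operator_frame_norm_lower[OF assms(2)[OF assms(6)], of x] unfolding LT by linarith
    moreover have "K'\<^sup>2 > 0" by (simp add: K'_def)
    ultimately show ?thesis by (simp add: field_simps)
  qed
  moreover have "A p / K'\<^sup>2 > 0" using Ap by (simp add: K'_def)
  ultimately show ?thesis by (intro frame_of_norm_bounds[OF adj F])
qed

end
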